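(* Assume that $$M_{p,w}^{r,r-1}=-\frac1w\ \ (r\ge1),\qquad M_{p,w}^{r,r}=0\ \ (r\ge0)$$ on $\mathcal I_p$, for every $r$ for which these functions (and the corresponding representations) are defined. Then, for $x\in\mathcal I_p$ and whenever the displayed quantities exist and the kernel hypotheses $\mathrm H$ (see context) hold at the indices used, namely $\mathrm H(0,0;h)$, $\mathrm H(k,k-1;h^{(k-1)})$ for $1\le k\le n$, $\mathrm H(k+1,k-1;h^{(k-1)})$ for $1\le k\le n-1$, and (for the last identity) $\mathrm H(n,n;h^{(n)})$, \begin{align*} f_{p,w,h}^{(n)}(x)&=\mathbb E\big[K_{p,w}^{n,n-1}(x,Z)\big(h^{(n-1)}(Z)-h^{(n-1)}(x)\big)\big],\qquad n\ge1,\\ f_{p,w,h}^{(n)}(x)&=\mathbb E\big[K_{p,w}^{n,n}(x,Z)h^{(n)}(Z)\big],\qquad n\ge0,\\ f_{p,w,h}^{(n)}(x)&=\mathbb E\big[K_{p,w}^{n,n+1}(x,Z)h^{(n+1)}(Z)\big],\qquad n\ge0. \end{align*}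
   Context: Setting. $p$ is a probability density on $\mathbb R$ and $Z$ a random variable with density $p$. There are $m\ge1$ and $-\infty\le l=e_0<e_1<\dots<e_m=u\le\infty$ with $\{p>0\}=\mathcal I_p:=\bigcup_{r=1}^m(e_{r-1},e_r)$, and $p$ is locally absolutely continuous on each $(e_{r-1},e_r)$. The weight $w:\mathbb R\to\mathbb R$ is nonzero on $\mathcal I_p$ and $wp$ is locally absolutely continuous on each $(e_{r-1},e_r)$. Put $P(x)=\int_l^xp$, $\overline P(x)=\int_x^up$, $\mathcal Ph=\mathbb E[h(Z)]$. For $h\in L^1(p)$, $f_{p,w,h}(x)=\frac1{w(x)p(x)}\int_l^x(h(t)-\mathcal Ph)p(t)\,dt$, $x\in\mathcal I_p$. Kernels. $\underline m_{p,w}=P/(wp)$ and $\overline m_{p,w}=\overline P/(wp)$ on $\mathcal I_p$; $\underline P_0=\overline P_0=p$ and, for $j\ge1$, $\underline P_j(x)=\int_l^x\underline P_{j-1}(t)\,dt$, $\overline P_j(x)=\int_x^u\overline P_{j-1}(t)\,dt$. For $i,j\ge0$ and $x,v\in\mathcal I_p$, $$K_{p,w}^{i,j}(x,v)=\frac1{p(v)}\Big[(-1)^j\overline m_{p,w}^{(i)}(x)\underline P_j(v)\mathbf 1_{\{v\le x\}}-\underline m_{p,w}^{(i)}(x)\overline P_j(v)\mathbf 1_{\{v>x\}}\Big],$$ and for $i\ge0$, $j\ge-1$, $M_{p,w}^{i,j}=(-1)^j\overline m_{p,w}^{(i)}\underline P_{j+1}-\underline m_{p,w}^{(i)}\overline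 P_{j+1}$. Superscripts in parentheses are ordinary derivatives. Kernel hypotheses $\mathrm H(i,j;g)$, for integers $i,j\ge0$ and $g:\mathbb R\to\mathbb R$: for every $x\in\mathcal I_p$, (a) $\underline P_{j+1}(x),\overline P_{j+1}(x)$ are finite; (b) the derivatives of $\underline m_{p,w},\overline m_{p,w}$ through order $i+1$ are finite and locally absolutely continuous near $x$; (c) $g$ is locally absolutely continuous and $\mathbb E[|K_{p,w}^{i,j}(x,Z)g(Z)|+|K_{p,w}^{i,j+1}(x,Z)g'(Z)|+|K_{p,w}^{i+1,j}(x,Z)g(Z)|]<\infty$; (d) $g(v)P(v)\to0$ and $g(v)\underline P_{j+1}(v)\to0$ as $v\downarrow l$, and $g(v)\overline P(v)\to0$ and $g(v)\overline P_{j+1}(v)\to0$ as $v\uparrow u$. *)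

theory Defs
  imports "HOL-Probability.Probability"
begin

definition abs_cont_on :: "real \<Rightarrow> real \<Rightarrow> (real \<Rightarrow> real) \<Rightarrow> bool" where
  "abs_cont_on a b f \<longleftrightarrow>
     (\<forall>\<epsilon>>0. \<exists>\<delta>>0. \<forall>D :: (real \<times> real) set.
        finite D \<and> (\<forall>(c, d)\<in>D. a \<le> c \<and> c \<le> d \<and> d \<le> b) \<and>
        disjoint_family_on (\<lambda>(c, d). {c<..<d}) D \<and> (\<Sum>(c, d)\<in>D. d - c) < \<delta>
        \<longrightarrow> (\<Sum>(c, d)\<in>D. \<bar>f d - f c\<bar>) < \<epsilon>)"

definition loc_abs_cont_on :: "real set \<Rightarrow> (real \<Rightarrow> real) \<Rightarrow> bool" where
  "loc_abs_cont_on U f \<longleftrightarrow> (\<forall>a b. a \<le> b \<and> {a..b} \<subseteq> U \<longrightarrow> abs_cont_on a b f)"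

text \<open>The \<open>k\<close>-th ordinary derivative is \<open>(deriv ^^ k) f\<close>. As \<^const>\<open>deriv\<close> is total, existence of
  \<open>f\<^sup>(\<^sup>n\<^sup>)\<close> on an open set \<open>U\<close> is a separate predicate.\<close>

definition times_differentiable_on :: "nat \<Rightarrow> (real \<Rightarrow> real) \<Rightarrow> real set \<Rightarrow> bool" where
  "times_differentiable_on n f U \<longleftrightarrow> (\<forall>k<n. \<forall>y\<in>U. (deriv ^^ k) f field_differentiable (at y))"

text \<open>\<open>E[g(Z)]\<close> and integrability of \<open>g(Z)\<close> are taken over the completed probability space: the
  derivative of a locally absolutely continuous function is defined only almost everywhere, and the
  arbitrary values of \<^const>\<open>deriv\<close> on the exceptional null set may destroy Borel measurability, but
  not measurability for the completion. For Borel \<open>g\<close> nothing changes.\<close>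

definition expect :: "'a measure \<Rightarrow> ('a \<Rightarrow> real) \<Rightarrow> (real \<Rightarrow> real) \<Rightarrow> real" where
  "expect \<Omega> Z g = (LINT \<omega>|completion \<Omega>. g (Z \<omega>))"

definition expect_finite :: "'a measure \<Rightarrow> ('a \<Rightarrow> real) \<Rightarrow> (real \<Rightarrow> real) \<Rightarrow> bool" where
  "expect_finite \<Omega> Z g \<longleftrightarrow> integrable (completion \<Omega>) (\<lambda>\<omega>. g (Z \<omega>))"

definition cdf_lower :: "(real \<Rightarrow> real) \<Rightarrow> ereal \<Rightarrow> real \<Rightarrow> real" where
  "cdf_lower p l x = (LINT t:{t. l < ereal t \<and> t \<le> x}|lebesgue. p t)"

definition cdf_upper :: "(real \<Rightarrow> real) \<Rightarrow> ereal \<Rightarrow> real \<Rightarrow> real" where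
  "cdf_upper p u x = (LINT t:{t. x \<le> t \<and> ereal t < u}|lebesgue. p t)"

text \<open>The iterated integrals of the density are \<open>[0,\<infinity>]\<close>-valued, since their finiteness is a hypothesis.\<close>

fun P_lower :: "(real \<Rightarrow> real) \<Rightarrow> ereal \<Rightarrow> nat \<Rightarrow> real \<Rightarrow> ennreal" where
  "P_lower p l 0 x = ennreal (p x)"
| "P_lower p l (Suc j) x = (\<integral>\<^sup>+t\<in>{t. l < ereal t \<and> t \<le> x}. P_lower p l j t \<partial>lborel)"

fun P_upper :: "(real \<Rightarrow> real) \<Rightarrow> ereal \<Rightarrow> nat \<Rightarrow> real \<Rightarrow> ennreal" where
  "P_upper p u 0 x = ennreal (p x)"
| "P_upper p u (Suc j) x = (\<integral>\<^sup>+t\<in>{t. x \<le> t \<and> ereal t < u}. P_upper p u j t \<partial>lborel)"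

definition m_lower :: "(real \<Rightarrow> real) \<Rightarrow> (real \<Rightarrow> real) \<Rightarrow> ereal \<Rightarrow> real \<Rightarrow> real" where
  "m_lower p w l x = cdf_lower p l x / (w x * p x)"

definition m_upper :: "(real \<Rightarrow> real) \<Rightarrow> (real \<Rightarrow> real) \<Rightarrow> ereal \<Rightarrow> real \<Rightarrow> real" where
  "m_upper p w u x = cdf_upper p u x / (w x * p x)"

definition f_sol ::
  "'a measure \<Rightarrow> ('a \<Rightarrow> real) \<Rightarrow> (real \<Rightarrow> real) \<Rightarrow> (real \<Rightarrow> real) \<Rightarrow> ereal
    \<Rightarrow> (real \<Rightarrow> real) \<Rightarrow> real \<Rightarrow> real" where
  "f_sol \<Omega> Z p w l h x =
     1 / (w x * p x) *
     (LINT t:{t. l < ereal t \<and> t \<le> x}|lebesgue. (h t - expect \<Omega> Z h) * p t)"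

definition K_kernel ::
  "(real \<Rightarrow> real) \<Rightarrow> (real \<Rightarrow> real) \<Rightarrow> ereal \<Rightarrow> ereal \<Rightarrow> nat \<Rightarrow> nat \<Rightarrow> real \<Rightarrow> real \<Rightarrow> real" where
  "K_kernel p w l u i j x v =
     1 / p v *
     ((-1) ^ j * (deriv ^^ i) (m_upper p w u) x * enn2real (P_lower p l j v) * indicator {v. v \<le> x} v
      - (deriv ^^ i) (m_lower p w l) x * enn2real (P_upper p u j v) * indicator {v. v > x} v)"

text \<open>The second index ranges over \<open>j \<ge> -1\<close>, hence is an integer.\<close>

definition M_kernel ::
  "(real \<Rightarrow> real) \<Rightarrow> (real \<Rightarrow> real) \<Rightarrow> ereal \<Rightarrow> ereal \<Rightarrow> nat \<Rightarrow> int \<Rightarrow> real \<Rightarrow> real" where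
  "M_kernel p w l u i j x =
     (-1) powi j * (deriv ^^ i) (m_upper p w u) x * enn2real (P_lower p l (nat (j + 1)) x)
     - (deriv ^^ i) (m_lower p w l) x * enn2real (P_upper p u (nat (j + 1)) x)"

text \<open>Limits \<open>v \<down> l\<close> and \<open>v \<up> u\<close> at possibly infinite end points are taken along
  \<open>at_right l\<close> and \<open>at_left u\<close> in the extended reals, as for interval integrals.\<close>

definition kernel_hyp ::
  "'a measure \<Rightarrow> ('a \<Rightarrow> real) \<Rightarrow> (real \<Rightarrow> real) \<Rightarrow> (real \<Rightarrow> real) \<Rightarrow> ereal \<Rightarrow> ereal \<Rightarrow> real set
    \<Rightarrow> nat \<Rightarrow> nat \<Rightarrow> (real \<Rightarrow> real) \<Rightarrow> bool" where
  "kernel_hyp \<Omega> Z p w l u I i j g \<longleftrightarrow>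
     (\<forall>x\<in>I.
        P_lower p l (j + 1) x < \<infinity> \<and> P_upper p u (j + 1) x < \<infinity> \<and>
        (\<exists>U. open U \<and> x \<in> U \<and>
           times_differentiable_on (i + 1) (m_lower p w l) U \<and>
           times_differentiable_on (i + 1) (m_upper p w u) U \<and>
           (\<forall>k\<le>i + 1. loc_abs_cont_on U ((deriv ^^ k) (m_lower p w l)) \<and>
                        loc_abs_cont_on U ((deriv ^^ k) (m_upper p w u)))) \<and>
        expect_finite \<Omega> Z (\<lambda>v. \<bar>K_kernel p w l u i j x v * g v\<bar>
                              + \<bar>K_kernel p w l u i (j + 1) x v * deriv g v\<bar>
                              + \<bar>K_kernel p w l u (i + 1) j x v * g v\<bar>)) \<and>
     loc_abs_cont_on UNIV g \<and>
     (((\<lambda>v. g v * cdf_lower p l v) \<circ> real_of_ereal) \<longlongrightarrow> 0) (at_right l) \<and>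
     (((\<lambda>v. g v * enn2real (P_lower p l (j + 1) v)) \<circ> real_of_ereal) \<longlongrightarrow> 0) (at_right l) \<and>
     (((\<lambda>v. g v * cdf_upper p u v) \<circ> real_of_ereal) \<longlongrightarrow> 0) (at_left u) \<and>
     (((\<lambda>v. g v * enn2real (P_upper p u (j + 1) v)) \<circ> real_of_ereal) \<longlongrightarrow> 0) (at_left u)"

text \<open>The hypothesis \<open>H(i,j; h\<^sup>(\<^sup>k\<^sup>))\<close>, which includes that \<open>h\<^sup>(\<^sup>k\<^sup>)\<close> exists as an ordinary derivative
  on the whole line. It contains everything needed for \<open>M\<^sup>i\<^sup>,\<^sup>j\<close> to be defined on \<open>I\<close>.\<close>

definition kernel_hyp_deriv ::
  "'a measure \<Rightarrow> ('a \<Rightarrow> real) \<Rightarrow> (real \<Rightarrow> real) \<Rightarrow> (real \<Rightarrow> real) \<Rightarrow> ereal \<Rightarrow> ereal \<Rightarrow> real set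
    \<Rightarrow> nat \<Rightarrow> nat \<Rightarrow> nat \<Rightarrow> (real \<Rightarrow> real) \<Rightarrow> bool" where
  "kernel_hyp_deriv \<Omega> Z p w l u I i j k h \<longleftrightarrow>
     times_differentiable_on k h UNIV \<and> kernel_hyp \<Omega> Z p w l u I i j ((deriv ^^ k) h)"

definition density_setting ::
  "'a measure \<Rightarrow> ('a \<Rightarrow> real) \<Rightarrow> (real \<Rightarrow> real) \<Rightarrow> (real \<Rightarrow> real) \<Rightarrow> nat \<Rightarrow> (nat \<Rightarrow> ereal)
    \<Rightarrow> real set \<Rightarrow> bool" where
  "density_setting \<Omega> Z p w m e I \<longleftrightarrow>
     prob_space \<Omega> \<and> (\<forall>x. 0 \<le> p x) \<and> distributed \<Omega> lborel Z (\<lambda>x. ennreal (p x)) \<and>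
     1 \<le> m \<and> (\<forall>r\<in>{1..m}. e (r - 1) < e r) \<and>
     I = (\<Union>r\<in>{1..m}. {x. e (r - 1) < ereal x \<and> ereal x < e r}) \<and>
     {x. 0 < p x} = I \<and>
     (\<forall>x\<in>I. w x \<noteq> 0) \<and>
     (\<forall>r\<in>{1..m}. loc_abs_cont_on {x. e (r - 1) < ereal x \<and> ereal x < e r} p \<and>
                   loc_abs_cont_on {x. e (r - 1) < ereal x \<and> ereal x < e r} (\<lambda>x. w x * p x))"

end

theory Submission
  imports Defs
begin

text \<open>Differentiating \<open>E[K\<^sup>i\<^sup>,\<^sup>j(x,Z) g(Z)]\<close> in \<open>x\<close> gives
  \<open>E[K\<^sup>i\<^sup>+\<^sup>1\<^sup>,\<^sup>j(x,Z) g(Z)] - g(x) M\<^sup>i\<^sup>,\<^sup>j\<^sup>-\<^sup>1(x)\<close>, and integrating by parts under the expectation gives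
  \<open>E[K\<^sup>i\<^sup>,\<^sup>j(x,Z) g(Z)] = g(x) M\<^sup>i\<^sup>,\<^sup>j(x) + E[K\<^sup>i\<^sup>,\<^sup>j\<^sup>+\<^sup>1(x,Z) g'(Z)]\<close>. As \<open>E[K\<^sup>i\<^sup>,\<^sup>j(x,Z)] = M\<^sup>i\<^sup>,\<^sup>j(x)\<close>, the
  assumptions on \<open>M\<close> make these two steps carry the representation of \<open>f\<^sup>(\<^sup>n\<^sup>)\<close> to that of \<open>f\<^sup>(\<^sup>n\<^sup>+\<^sup>1\<^sup>)\<close>.

  Integration by parts is Fubini's theorem applied to \<open>P\<^sub>j(t) g'(s)\<close> on \<open>l < t \<le> s \<le> x\<close>, whose absolute
  integral is that of \<open>P\<^sub>j\<^sub>+\<^sub>1 |g'|\<close>. It rests on the fundamental theorem of calculus for absolutely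
  continuous \<open>g\<close>: the variation function of \<open>g\<close> is monotone and absolutely continuous, hence the
  distribution function of a measure with a Lebesgue density.\<close>

subsection \<open>Absolutely continuous functions\<close>

text \<open>Write g for the n-th derivative of h. Differentiating the n-th representation adds g/w,
  because the boundary coefficient -M^{n,n-1} equals 1/w; at n = 0 this is the identity that the two
  tail probabilities add up to 1. Integration by parts at (n+1,n), or subtraction of the constant
  g(x) inside the expectation, brings in g M^{n+1,n} = -g/w, and the two contributions cancel. When
  M^{n,n} = 0, one more integration by parts raises the second index at no cost.

  Two obstacles shape the rest. First, \<open>deriv g\<close> is meaningful only almost everywhere
  and need not be Borel, so every integral is computed with a Borel function \<open>G\<close> equal
  to it almost everywhere, and expectations are moved to Lebesgue measure through the completion.
  Second, a kernel is a sum of two halves with coefficients depending on x. Finiteness of its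
  expectation says nothing about a half whose coefficient vanishes at x, so the halves are separated
  and each integrability claim is tied to a nonzero coefficient.\<close>

definition subdivision :: "real \<Rightarrow> real \<Rightarrow> (real \<times> real) set \<Rightarrow> bool" where
  "subdivision a b D \<longleftrightarrow> finite D \<and> (\<forall>(c, d)\<in>D. a \<le> c \<and> c < d \<and> d \<le> b) \<and>
     disjoint_family_on (\<lambda>(c, d). {c<..<d}) D"

definition var_sum :: "(real \<Rightarrow> real) \<Rightarrow> (real \<times> real) set \<Rightarrow> real" where
  "var_sum f D = (\<Sum>(c, d)\<in>D. \<bar>f d - f c\<bar>)"

text \<open>The pairs need not cover the interval; since filling gaps only adds nonnegative terms,
  the supremum is still the total variation.\<close>

definition variation :: "(real \<Rightarrow> real) \<Rightarrow> real \<Rightarrow> real \<Rightarrow> real" where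
  "variation f a b = Sup (var_sum f ` {D. subdivision a b D})"

lemma subdivision_empty [simp]: "subdivision a b {}"
  by (auto simp: subdivision_def disjoint_family_on_def)

lemma subdivision_subset: "subdivision a b D \<Longrightarrow> E \<subseteq> D \<Longrightarrow> subdivision a b E"
  unfolding subdivision_def
  by (auto dest: finite_subset intro: disjoint_family_on_mono)

lemma subdivision_mono:
  "subdivision a b D \<Longrightarrow> a' \<le> a \<Longrightarrow> b \<le> b' \<Longrightarrow> subdivision a' b' D"
  unfolding subdivision_def by fastforce

lemma abs_cont_on_iff_subdivision:
  "abs_cont_on a b f \<longleftrightarrow>
    (\<forall>\<epsilon>>0. \<exists>\<delta>>0. \<forall>D. subdivision a b D \<and> (\<Sum>(c, d)\<in>D. d - c) < \<delta> \<longrightarrow> var_sum f D < \<epsilon>)"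
    (is "?L \<longleftrightarrow> ?R")
proof
  assume ?L
  show ?R
  proof (intro allI impI)
    fix \<epsilon> :: real assume "\<epsilon> > 0"
    with \<open>?L\<close> obtain \<delta> where d: "\<delta> > 0"
      "\<And>D. finite D \<and> (\<forall>(c, d)\<in>D. a \<le> c \<and> c \<le> d \<and> d \<le> b) \<and>
        disjoint_family_on (\<lambda>(c, d). {c<..<d}) D \<and> (\<Sum>(c, d)\<in>D. d - c) < \<delta>
        \<Longrightarrow> (\<Sum>(c, d)\<in>D. \<bar>f d - f c\<bar>) < \<epsilon>"
      unfolding abs_cont_on_def by meson
    show "\<exists>\<delta>>0. \<forall>D. subdivision a b D \<and> (\<Sum>(c, d)\<in>D. d - c) < \<delta> \<longrightarrow> var_sum f D < \<epsilon>"
    proof (rule exI[of _ \<delta>], intro conjI allI impI)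
      fix D assume D: "subdivision a b D \<and> (\<Sum>(c, d)\<in>D. d - c) < \<delta>"
      show "var_sum f D < \<epsilon>"
        unfolding var_sum_def by (rule d(2)) (use D in \<open>auto simp: subdivision_def dest!: bspec\<close>)
    qed fact
  qed
next
  assume ?R
  show ?L
    unfolding abs_cont_on_def
  proof (intro allI impI)
    fix \<epsilon> :: real assume "\<epsilon> > 0"
    with \<open>?R\<close> obtain \<delta> where d: "\<delta> > 0"
      "\<And>D. subdivision a b D \<Longrightarrow> (\<Sum>(c, d)\<in>D. d - c) < \<delta> \<Longrightarrow> var_sum f D < \<epsilon>"
      by meson
    show "\<exists>\<delta>>0. \<forall>D. finite D \<and> (\<forall>(c, d)\<in>D. a \<le> c \<and> c \<le> d \<and> d \<le> b) \<and>
        disjoint_family_on (\<lambda>(c, d). {c<..<d}) D \<and> (\<Sum>(c, d)\<in>D. d - c) < \<delta>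
        \<longrightarrow> (\<Sum>(c, d)\<in>D. \<bar>f d - f c\<bar>) < \<epsilon>"
    proof (rule exI[of _ \<delta>], intro conjI allI impI)
      fix D assume D: "finite D \<and> (\<forall>(c, d)\<in>D. a \<le> c \<and> c \<le> d \<and> d \<le> b) \<and>
        disjoint_family_on (\<lambda>(c, d). {c<..<d}) D \<and> (\<Sum>(c, d)\<in>D. d - c) < \<delta>"
      define E where "E = {q\<in>D. fst q < snd q}"
      have E: "subdivision a b E"
        unfolding subdivision_def
      proof (intro conjI)
        show "finite E" using D by (auto simp: E_def)
        show "\<forall>(c, d)\<in>E. a \<le> c \<and> c < d \<and> d \<le> b" using D by (auto simp: E_def)
        show "disjoint_family_on (\<lambda>(c, d). {c<..<d}) E"
          by (rule disjoint_family_on_mono[of _ D]) (use D in \<open>auto simp: E_def\<close>)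
      qed
      have ED: "E \<subseteq> D" by (auto simp: E_def)
      have eq: "\<forall>q\<in>D - E. snd q = fst q"
      proof
        fix q assume "q \<in> D - E"
        moreover from this have "fst q \<le> snd q" using D by (auto dest!: bspec[of D _ q])
        ultimately show "snd q = fst q" by (auto simp: E_def)
      qed
      have "(\<Sum>(c, d)\<in>E. d - c) = (\<Sum>(c, d)\<in>D. d - c)"
        by (rule sum.mono_neutral_left[OF _ ED]) (use D eq in \<open>simp_all add: case_prod_beta\<close>)
      moreover have "var_sum f E = (\<Sum>(c, d)\<in>D. \<bar>f d - f c\<bar>)"
        unfolding var_sum_def
        by (rule sum.mono_neutral_left[OF _ ED]) (use D eq in \<open>simp_all add: case_prod_beta\<close>)
      ultimately show "(\<Sum>(c, d)\<in>D. \<bar>f d - f c\<bar>) < \<epsilon>"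
        using d(2)[OF E] D by simp
    qed fact
  qed
qed

lemma abs_cont_onD:
  assumes "abs_cont_on a b f" "\<epsilon> > 0"
  obtains \<delta> where "\<delta> > 0"
    "\<And>D. subdivision a b D \<Longrightarrow> (\<Sum>(c, d)\<in>D. d - c) < \<delta> \<Longrightarrow> var_sum f D < \<epsilon>"
  using assms unfolding abs_cont_on_iff_subdivision by meson

lemma abs_cont_on_imp_continuous_on:
  assumes "abs_cont_on a b f"
  shows "continuous_on {a..b} f"
  unfolding continuous_on_iff
proof (intro ballI allI impI)
  fix x \<epsilon> :: real assume x: "x \<in> {a..b}" and "\<epsilon> > 0"
  obtain \<delta> where d: "\<delta> > 0"
    "\<And>D. subdivision a b D \<Longrightarrow> (\<Sum>(c, d)\<in>D. d - c) < \<delta> \<Longrightarrow> var_sum f D < \<epsilon>"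
    using abs_cont_onD[OF assms \<open>\<epsilon> > 0\<close>] by metis
  have *: "\<bar>f v - f u\<bar> < \<epsilon>" if "u \<in> {a..b}" "v \<in> {a..b}" "u < v" "v - u < \<delta>" for u v
    using d(2)[of "{(u, v)}"] that
    by (auto simp: subdivision_def disjoint_family_on_def var_sum_def)
  show "\<exists>d>0. \<forall>x'\<in>{a..b}. dist x' x < d \<longrightarrow> dist (f x') (f x) < \<epsilon>"
  proof (intro exI[of _ \<delta>] conjI ballI impI)
    fix y assume y: "y \<in> {a..b}" "dist y x < \<delta>"
    consider "y < x" | "y = x" | "y > x" by linarith
    then show "dist (f y) (f x) < \<epsilon>"
      using *[of x y] *[of y x] x y \<open>\<epsilon> > 0\<close> by cases (auto simp: dist_real_def abs_minus_commute)
  qed fact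
qed

lemma loc_abs_cont_on_imp_continuous_on:
  assumes "loc_abs_cont_on U f" "open U"
  shows "continuous_on U f"
proof (rule continuous_at_imp_continuous_on, rule ballI)
  fix x assume "x \<in> U"
  then obtain r where r: "r > 0" "cball x r \<subseteq> U"
    using \<open>open U\<close> open_contains_cball by blast
  then have "abs_cont_on (x - r) (x + r) f"
    using assms(1) by (auto simp: loc_abs_cont_on_def cball_eq_atLeastAtMost)
  then have "continuous_on {x - r..x + r} f"
    by (rule abs_cont_on_imp_continuous_on)
  then show "isCont f x"
    using r(1) by (intro continuous_on_interior[of "{x - r..x + r}"]) auto
qed

lemma abs_cont_on_diff:
  assumes "abs_cont_on a b f" "abs_cont_on a b g"
  shows "abs_cont_on a b (\<lambda>x. f x - g x)"
  unfolding abs_cont_on_iff_subdivision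
proof (intro allI impI)
  fix \<epsilon> :: real assume "\<epsilon> > 0"
  then have e: "\<epsilon> / 2 > 0" by simp
  obtain d1 where d1: "d1 > 0"
    "\<And>D. subdivision a b D \<Longrightarrow> (\<Sum>(c, d)\<in>D. d - c) < d1 \<Longrightarrow> var_sum f D < \<epsilon> / 2"
    using abs_cont_onD[OF assms(1) e] by metis
  obtain d2 where d2: "d2 > 0"
    "\<And>D. subdivision a b D \<Longrightarrow> (\<Sum>(c, d)\<in>D. d - c) < d2 \<Longrightarrow> var_sum g D < \<epsilon> / 2"
    using abs_cont_onD[OF assms(2) e] by metis
  show "\<exists>\<delta>>0. \<forall>D. subdivision a b D \<and> (\<Sum>(c, d)\<in>D. d - c) < \<delta> \<longrightarrow>
      var_sum (\<lambda>x. f x - g x) D < \<epsilon>"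
  proof (intro exI[of _ "min d1 d2"] conjI allI impI)
    fix D assume D: "subdivision a b D \<and> (\<Sum>(c, d)\<in>D. d - c) < min d1 d2"
    have "var_sum (\<lambda>x. f x - g x) D \<le> var_sum f D + var_sum g D"
      unfolding var_sum_def sum.distrib[symmetric] by (intro sum_mono) auto
    with d1(2)[of D] d2(2)[of D] D show "var_sum (\<lambda>x. f x - g x) D < \<epsilon>" by auto
  qed (use d1 d2 in auto)
qed

text \<open>Disjoint open intervals have additive measure. This turns a small open cover of a null
  set into the length bound that absolute continuity asks for.\<close>

lemma subdivision_length_le_emeasure:
  assumes "subdivision a b D" "(\<Union>(c, d)\<in>D. {c<..<d}) \<subseteq> U" "U \<in> sets lborel"
  shows "ennreal (\<Sum>(c, d)\<in>D. d - c) \<le> emeasure lborel U"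
proof -
  have fin: "finite D" and D: "\<And>c d. (c, d) \<in> D \<Longrightarrow> a \<le> c \<and> c < d \<and> d \<le> b"
    using assms(1) by (auto simp: subdivision_def)
  have "ennreal (\<Sum>(c, d)\<in>D. d - c) = (\<Sum>q\<in>D. ennreal (case q of (c, d) \<Rightarrow> d - c))"
    by (rule sum_ennreal[symmetric]) (auto dest: D)
  also have "\<dots> = (\<Sum>q\<in>D. emeasure lborel (case q of (c, d) \<Rightarrow> {c<..<d}))"
    by (rule sum.cong) (auto dest: D)
  also have "\<dots> = emeasure lborel (\<Union>q\<in>D. (\<lambda>(c, d). {c<..<d}) q)"
    by (rule sum_emeasure) (use assms fin in \<open>auto simp: subdivision_def\<close>)
  also have "\<dots> \<le> emeasure lborel U"
    using assms(2,3) by (rule emeasure_mono)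
  finally show ?thesis .
qed

lemma subdivision_length_le:
  assumes "subdivision a b D" "a \<le> b"
  shows "(\<Sum>(c, d)\<in>D. d - c) \<le> b - a"
proof -
  have "(\<Union>(c, d)\<in>D. {c<..<d}) \<subseteq> {a..b}"
    using assms(1) by (fastforce simp: subdivision_def)
  from subdivision_length_le_emeasure[OF assms(1) this] show ?thesis
    using assms(2) by (simp add: ennreal_le_iff)
qed

text \<open>Pairs from different \<open>E q\<close> span nonempty intervals inside disjoint ones, so
  the sets \<open>E q\<close> are disjoint and no pair is counted twice in the second claim.\<close>

lemma subdivision_UN:
  assumes D: "subdivision a b D" and E: "\<And>c d. (c, d) \<in> D \<Longrightarrow> subdivision c d (E (c, d))"
  shows "subdivision a b (\<Union>q\<in>D. E q)"
    and "(\<Sum>q\<in>(\<Union>q\<in>D. E q). (\<phi> q :: real)) = (\<Sum>q\<in>D. \<Sum>r\<in>E q. \<phi> r)"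
proof -
  have fin: "finite D" and D': "\<And>c d. (c, d) \<in> D \<Longrightarrow> a \<le> c \<and> c < d \<and> d \<le> b"
    and disj: "disjoint_family_on (\<lambda>(c, d). {c<..<d}) D"
    using D by (auto simp: subdivision_def)
  have E': "c \<le> s \<and> s < t \<and> t \<le> d" if "(c, d) \<in> D" "(s, t) \<in> E (c, d)" for c d s t
    using E[OF that(1)] that(2) by (auto simp: subdivision_def)
  have disjE: "{s<..<t} \<inter> {s'<..<t'} = {}"
    if "(c, d) \<in> D" "(s, t) \<in> E (c, d)" "(c', d') \<in> D" "(s', t') \<in> E (c', d')" "(c, d) \<noteq> (c', d')"
    for c d c' d' s t s' t'
  proof -
    have "{c<..<d} \<inter> {c'<..<d'} = {}"
      using disjoint_family_onD[OF disj that(1,3,5)] by simp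
    moreover have "{s<..<t} \<subseteq> {c<..<d}" "{s'<..<t'} \<subseteq> {c'<..<d'}"
      using E'[OF that(1,2)] E'[OF that(3,4)] by auto
    ultimately show ?thesis by blast
  qed
  have finE: "finite (E q)" if "q \<in> D" for q
    using E[of "fst q" "snd q"] that by (auto simp: subdivision_def)
  show "subdivision a b (\<Union>q\<in>D. E q)"
    unfolding subdivision_def
  proof (intro conjI)
    show "finite (\<Union>q\<in>D. E q)" using fin finE by auto
    show "\<forall>(c, d)\<in>\<Union> (E ` D). a \<le> c \<and> c < d \<and> d \<le> b"
      using D' E' by fastforce
    show "disjoint_family_on (\<lambda>(c, d). {c<..<d}) (\<Union> (E ` D))"
      unfolding disjoint_family_on_def
    proof (intro ballI impI)
      fix r r' assume r: "r \<in> \<Union> (E ` D)" and r': "r' \<in> \<Union> (E ` D)" and ne: "r \<noteq> r'"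
      obtain s t where [simp]: "r = (s, t)" by (cases r)
      obtain s' t' where [simp]: "r' = (s', t')" by (cases r')
      obtain c d where cd: "(c, d) \<in> D" "(s, t) \<in> E (c, d)" using r by auto
      obtain c' d' where cd': "(c', d') \<in> D" "(s', t') \<in> E (c', d')" using r' by auto
      show "(\<lambda>(c, d). {c<..<d}) r \<inter> (\<lambda>(c, d). {c<..<d}) r' = {}"
      proof (cases "(c, d) = (c', d')")
        case True
        with E[OF cd(1)] cd cd' ne show ?thesis
          unfolding subdivision_def disjoint_family_on_def by fastforce
      next
        case False
        with disjE[OF cd cd'] show ?thesis by simp
      qed
    qed
  qed
  have "E q \<inter> E q' = {}" if "q \<in> D" "q' \<in> D" "q \<noteq> q'" for q q'
  proof (rule ccontr)
    assume "E q \<inter> E q' \<noteq> {}"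
    then obtain s t where st: "(s, t) \<in> E q" "(s, t) \<in> E q'" by auto
    have "{s<..<t} = {}"
      using disjE[of "fst q" "snd q" s t "fst q'" "snd q'" s t] st that by auto
    with E'[of "fst q" "snd q" s t] st that show False by auto
  qed
  then show "(\<Sum>q\<in>(\<Union>q\<in>D. E q). \<phi> q) = (\<Sum>q\<in>D. \<Sum>r\<in>E q. \<phi> r)"
    using fin finE by (intro sum.UNION_disjoint) auto
qed

text \<open>At most one interval has x in its interior. Cutting it at x can only increase the sum,
  by the triangle inequality; all others lie on one side.\<close>

lemma subdivision_split:
  assumes D: "subdivision a b D" and x: "a \<le> x" "x \<le> b"
  obtains D1 D2 where "subdivision a x D1" "subdivision x b D2"
    "var_sum f D \<le> var_sum f D1 + var_sum f D2"
proof -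
  have fin: "finite D" and D': "\<And>c d. (c, d) \<in> D \<Longrightarrow> a \<le> c \<and> c < d \<and> d \<le> b"
    and disj: "disjoint_family_on (\<lambda>(c, d). {c<..<d}) D"
    using D by (auto simp: subdivision_def)
  have disj': "{c<..<d} \<inter> {c'<..<d'} = {}" if "(c, d) \<in> D" "(c', d') \<in> D" "(c, d) \<noteq> (c', d')"
    for c d c' d'
    using disjoint_family_onD[OF disj that] by simp
  define D1 where "D1 = {q\<in>D. snd q \<le> x}"
  define D2 where "D2 = {q\<in>D. x \<le> fst q}"
  have fin12: "finite D1" "finite D2" using fin by (auto simp: D1_def D2_def)
  have dis12: "D1 \<inter> D2 = {}" by (force simp: D1_def D2_def dest: D')
  have sub1: "subdivision a x D1"
    using subdivision_subset[OF D, of D1] by (auto simp: subdivision_def D1_def dest: D')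
  have sub2: "subdivision x b D2"
    using subdivision_subset[OF D, of D2] by (auto simp: subdivision_def D2_def dest: D')
  show ?thesis
  proof (cases "\<exists>c d. (c, d) \<in> D \<and> c < x \<and> x < d")
    case False
    then have "D = D1 \<union> D2" by (force simp: D1_def D2_def)
    then have "var_sum f D = var_sum f D1 + var_sum f D2"
      unfolding var_sum_def using sum.union_disjoint[OF fin12 dis12] by simp
    with sub1 sub2 show ?thesis by (intro that) auto
  next
    case True
    then obtain c d where cd: "(c, d) \<in> D" "c < x" "x < d" by blast
    have other: "d' \<le> c \<or> d \<le> c'" if q: "(c', d') \<in> D" "(c', d') \<noteq> (c, d)" for c' d'
    proof (rule ccontr)
      assume "\<not> (d' \<le> c \<or> d \<le> c')"
      \<comment> \<open>This is the midpoint of the overlap of the two intervals.\<close>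
      then have "(max c c' + min d d') / 2 \<in> {c<..<d} \<inter> {c'<..<d'}"
        using D'[OF q(1)] cd by (auto simp: max_def min_def field_simps)
      with disj'[OF q(1) cd(1) q(2)] show False by blast
    qed
    have Deq: "D = insert (c, d) (D1 \<union> D2)"
      using cd other by (force simp: D1_def D2_def)
    have notin: "(c, d) \<notin> D1 \<union> D2" using cd by (auto simp: D1_def D2_def)
    have o1: "d' \<le> c" if "(c', d') \<in> D1" for c' d'
      using that other[of c' d'] cd by (auto simp: D1_def dest: D')
    have o2: "d \<le> c'" if "(c', d') \<in> D2" for c' d'
      using that other[of c' d'] cd by (auto simp: D2_def dest: D')
    have n1: "(c, x) \<notin> D1" using o1[of c x] cd by auto
    have n2: "(x, d) \<notin> D2" using o2[of x d] cd by auto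
    have s1: "subdivision a x (insert (c, x) D1)"
      using sub1 cd D'[OF cd(1)] o1 unfolding subdivision_def
      by (auto simp: disjoint_family_on_insert[OF n1] dest: o1)
    have s2: "subdivision x b (insert (x, d) D2)"
      using sub2 cd D'[OF cd(1)] o2 unfolding subdivision_def
      by (auto simp: disjoint_family_on_insert[OF n2] dest: o2)
    have "var_sum f D = \<bar>f d - f c\<bar> + (var_sum f D1 + var_sum f D2)"
      unfolding var_sum_def Deq using notin fin12 sum.union_disjoint[OF fin12 dis12] by simp
    also have "\<dots> \<le> (\<bar>f x - f c\<bar> + var_sum f D1) + (\<bar>f d - f x\<bar> + var_sum f D2)" by simp
    also have "\<dots> = var_sum f (insert (c, x) D1) + var_sum f (insert (x, d) D2)"
      unfolding var_sum_def using n1 n2 fin12 by simp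
    finally show ?thesis using s1 s2 by (intro that)
  qed
qed

text \<open>With \<delta> chosen for \<epsilon> = 1, each piece of length at most \<delta>/2, hence
  strictly below \<delta>, contributes less than 1. Induction on the number of pieces needed to
  exhaust the interval bounds the whole sum.\<close>

lemma abs_cont_on_bounded_variation:
  assumes ac: "abs_cont_on a b f" and "a \<le> b"
  shows "bdd_above (var_sum f ` {D. subdivision a b D})"
proof -
  obtain \<delta> where d: "\<delta> > 0"
    "\<And>D. subdivision a b D \<Longrightarrow> (\<Sum>(c, d)\<in>D. d - c) < \<delta> \<Longrightarrow> var_sum f D < 1"
    using abs_cont_onD[OF ac, of 1] by auto
  have *: "var_sum f D \<le> real n" if "subdivision a (min b (a + real n * (\<delta> / 2))) D" for n D
    using that
  proof (induction n arbitrary: D)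
    case 0
    have "(c, d) \<notin> D" for c d
      using 0 \<open>a \<le> b\<close> unfolding subdivision_def by fastforce
    then have "D = {}" by auto
    then show ?case by (simp add: var_sum_def)
  next
    case (Suc n)
    let ?x = "min b (a + real n * (\<delta> / 2))" and ?y = "min b (a + real (Suc n) * (\<delta> / 2))"
    have xy: "a \<le> ?x" "?x \<le> ?y" "?y - ?x < \<delta>" "?y \<le> b"
      using d(1) \<open>a \<le> b\<close> by (auto simp: min_def field_simps)
    obtain D1 D2 where s: "subdivision a ?x D1" "subdivision ?x ?y D2"
      "var_sum f D \<le> var_sum f D1 + var_sum f D2"
      using subdivision_split[OF Suc.prems xy(1,2)] by metis
    have "(\<Sum>(c, d)\<in>D2. d - c) < \<delta>"
      using subdivision_length_le[OF s(2) xy(2)] xy(3) by linarith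
    then have "var_sum f D2 < 1"
      using d(2)[OF subdivision_mono[OF s(2) xy(1,4)]] by simp
    with Suc.IH[OF s(1)] s(3) show ?case by simp
  qed
  obtain n :: nat where "real n * (\<delta> / 2) > b - a"
    using d(1) reals_Archimedean3[of "\<delta> / 2"] by (metis half_gt_zero)
  then have "min b (a + real n * (\<delta> / 2)) = b" by auto
  with *[where n = n] show ?thesis by (auto simp: bdd_above_def)
qed

section \<open>The variation function of a locally absolutely continuous function\<close>

context
  fixes f :: "real \<Rightarrow> real"
  assumes ac: "loc_abs_cont_on UNIV f"
begin

lemma loc_ac: "a \<le> b \<Longrightarrow> abs_cont_on a b f"
  using ac by (auto simp: loc_abs_cont_on_def)

lemma var_sum_le_variation: "subdivision a b D \<Longrightarrow> a \<le> b \<Longrightarrow> var_sum f D \<le> variation f a b"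
  unfolding variation_def using abs_cont_on_bounded_variation[OF loc_ac]
  by (intro cSup_upper) auto

lemma variation_approx:
  assumes "a \<le> b" "\<eta> > 0"
  obtains D where "subdivision a b D" "variation f a b < var_sum f D + \<eta>"
proof -
  have "\<exists>y\<in>var_sum f ` {D. subdivision a b D}. variation f a b - \<eta> < y"
    unfolding variation_def
  proof (rule less_cSupD)
    show "var_sum f ` {D. subdivision a b D} \<noteq> {}" using subdivision_empty by blast
  qed (use \<open>\<eta> > 0\<close> in simp)
  then show ?thesis using that by force
qed

lemma variation_le:
  assumes "\<And>D. subdivision a b D \<Longrightarrow> var_sum f D \<le> c"
  shows "variation f a b \<le> c"
  unfolding variation_def using assms subdivision_empty by (intro cSup_least) blast+

lemma variation_diff_le: "a \<le> b \<Longrightarrow> \<bar>f b - f a\<bar> \<le> variation f a b"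
  using var_sum_le_variation[of a b "{(a, b)}"] var_sum_le_variation[of a b "{}"]
  by (cases "a = b") (auto simp: var_sum_def subdivision_def disjoint_family_on_def)

text \<open>Replacing each interval by a nearly optimal family inside it does not increase the total
  length, so the bound for sums of increments passes to the suprema. This serves both for
  superadditivity of the variation and for absolute continuity of the variation function.\<close>

lemma variation_sum_less:
  assumes D: "subdivision a b D" and \<delta>: "(\<Sum>(c, d)\<in>D. d - c) < \<delta>"
    and small: "\<And>D. subdivision a b D \<Longrightarrow> (\<Sum>(c, d)\<in>D. d - c) < \<delta> \<Longrightarrow> var_sum f D \<le> \<epsilon>"
  shows "(\<Sum>(c, d)\<in>D. variation f c d) \<le> \<epsilon>"
proof (rule field_le_epsilon)
  fix \<eta> :: real assume "\<eta> > 0"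
  have fin: "finite D" and D': "\<And>c d. (c, d) \<in> D \<Longrightarrow> a \<le> c \<and> c < d \<and> d \<le> b"
    using D by (auto simp: subdivision_def)
  \<comment> \<open>The error \<eta> is shared among the intervals; the summand 1 keeps the share
    positive when \<open>D\<close> is empty.\<close>
  define \<eta>' where "\<eta>' = \<eta> / (1 + real (card D))"
  have \<eta>': "\<eta>' > 0" using \<open>\<eta> > 0\<close> by (simp add: \<eta>'_def add_pos_nonneg)
  have "\<forall>q\<in>D. \<exists>E. subdivision (fst q) (snd q) E \<and> variation f (fst q) (snd q) < var_sum f E + \<eta>'"
  proof
    fix q assume "q \<in> D"
    then have "fst q \<le> snd q" using D'[of "fst q" "snd q"] by auto
    from variation_approx[OF this \<eta>']
    show "\<exists>E. subdivision (fst q) (snd q) E \<and> variation f (fst q) (snd q) < var_sum f E + \<eta>'" by metis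
  qed
  then obtain E where E: "\<And>q. q \<in> D \<Longrightarrow> subdivision (fst q) (snd q) (E q)"
    "\<And>q. q \<in> D \<Longrightarrow> variation f (fst q) (snd q) < var_sum f (E q) + \<eta>'"
    by metis
  have E': "subdivision c d (E (c, d))" if "(c, d) \<in> D" for c d using E(1)[OF that] by simp
  note U = subdivision_UN[OF D, of E, OF E']
  have "(\<Sum>(c, d)\<in>(\<Union>q\<in>D. E q). d - c) = (\<Sum>q\<in>D. \<Sum>(c, d)\<in>E q. d - c)"
    by (rule U(2))
  also have "\<dots> \<le> (\<Sum>(c, d)\<in>D. d - c)"
  proof (rule sum_mono)
    fix q assume q: "q \<in> D"
    obtain c d where [simp]: "q = (c, d)" by (cases q)
    show "(\<Sum>(c, d)\<in>E q. d - c) \<le> (case q of (c, d) \<Rightarrow> d - c)"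
      using subdivision_length_le[OF E'[of c d]] q D'[of c d] by auto
  qed
  finally have len: "(\<Sum>(c, d)\<in>(\<Union>q\<in>D. E q). d - c) < \<delta>" using \<delta> by simp
  have "(\<Sum>(c, d)\<in>D. variation f c d) \<le> (\<Sum>q\<in>D. var_sum f (E q) + \<eta>')"
    by (rule sum_mono) (use E(2) in \<open>force simp: less_imp_le\<close>)
  also have "\<dots> = (\<Sum>q\<in>D. var_sum f (E q)) + real (card D) * \<eta>'" by (simp add: sum.distrib)
  also have "(\<Sum>q\<in>D. var_sum f (E q)) = var_sum f (\<Union>q\<in>D. E q)"
    unfolding var_sum_def by (rule U(2)[symmetric])
  also have "\<dots> \<le> \<epsilon>" by (rule small[OF U(1) len])
  also have "real (card D) * \<eta>' \<le> \<eta>"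
    using \<open>\<eta> > 0\<close> by (simp add: \<eta>'_def field_simps)
  finally show "(\<Sum>(c, d)\<in>D. variation f c d) \<le> \<epsilon> + \<eta>" by simp
qed

lemma variation_refl [simp]: "variation f a a = 0"
proof (rule antisym)
  show "variation f a a \<le> 0"
  proof (rule variation_le)
    fix D assume D: "subdivision a a D"
    have "D = {}"
    proof (rule ccontr)
      assume "D \<noteq> {}"
      then obtain c d where "(c, d) \<in> D" by auto
      with D show False unfolding subdivision_def by fastforce
    qed
    then show "var_sum f D \<le> 0" by (simp add: var_sum_def)
  qed
  show "0 \<le> variation f a a" using variation_diff_le[of a a] by simp
qed

lemma variation_add:
  assumes "a \<le> x" "x \<le> b"
  shows "variation f a b = variation f a x + variation f x b"
proof (cases "a = x \<or> x = b")
  case True then show ?thesis by auto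
next
  case False
  then have lt: "a < x" "x < b" using assms by auto
  show ?thesis
  proof (rule antisym)
    show "variation f a b \<le> variation f a x + variation f x b"
    proof (rule variation_le)
      fix D assume "subdivision a b D"
      then obtain D1 D2 where "subdivision a x D1" "subdivision x b D2"
        "var_sum f D \<le> var_sum f D1 + var_sum f D2"
        using subdivision_split assms by metis
      then show "var_sum f D \<le> variation f a x + variation f x b"
        using var_sum_le_variation[of a x D1] var_sum_le_variation[of x b D2] assms by linarith
    qed
    \<comment> \<open>Superadditivity: \<delta> = b - a + 1 exceeds the total length, which makes
      the length condition vacuous, and \<epsilon> is the variation over [a,b] itself. Both pairs
      are nondegenerate because the cases a = x and x = b are already settled.\<close>
    have "(\<Sum>(c, d)\<in>{(a, x), (x, b)}. variation f c d) \<le> variation f a b"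
    proof (rule variation_sum_less[where a = a and b = b and \<delta> = "b - a + 1"])
      show "subdivision a b {(a, x), (x, b)}"
        using lt by (auto simp: subdivision_def disjoint_family_on_def)
    qed (use lt assms var_sum_le_variation in auto)
    then show "variation f a x + variation f x b \<le> variation f a b" using lt by simp
  qed
qed

text \<open>Anchored at 0, with a minus sign to the left, so that increments are variations on the
  whole line.\<close>

definition var_fun :: "real \<Rightarrow> real" where
  "var_fun x = (if 0 \<le> x then variation f 0 x else - variation f x 0)"

lemma var_fun_diff: "x \<le> y \<Longrightarrow> var_fun y - var_fun x = variation f x y"
  using variation_add[of 0 x y] variation_add[of x 0 y] variation_add[of x y 0]
  by (auto simp: var_fun_def)

lemma mono_var_fun: "mono var_fun"
proof (rule monoI)
  fix x y :: real assume "x \<le> y"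
  then show "var_fun x \<le> var_fun y"
    using var_fun_diff[of x y] variation_diff_le[of x y] by linarith
qed

text \<open>The second half of the Jordan decomposition f = \<open>var_fun\<close> -
  (\<open>var_fun\<close> - f).\<close>

lemma mono_var_fun_diff: "mono (\<lambda>x. var_fun x - f x)"
proof (rule monoI)
  fix x y :: real assume "x \<le> y"
  then show "var_fun x - f x \<le> var_fun y - f y"
    using var_fun_diff[of x y] variation_diff_le[of x y] by linarith
qed

lemma abs_cont_on_var_fun:
  assumes "a \<le> b"
  shows "abs_cont_on a b var_fun"
  unfolding abs_cont_on_iff_subdivision
proof (intro allI impI)
  fix \<epsilon> :: real assume "\<epsilon> > 0"
  \<comment> \<open>Passing to suprema gives only a weak inequality; halving \<epsilon> makes it
    strict.\<close>
  then have "\<epsilon> / 2 > 0" by simp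
  then obtain \<delta> where d: "\<delta> > 0"
    "\<And>D. subdivision a b D \<Longrightarrow> (\<Sum>(c, d)\<in>D. d - c) < \<delta> \<Longrightarrow> var_sum f D < \<epsilon> / 2"
    using abs_cont_onD[OF loc_ac[OF assms]] by metis
  show "\<exists>\<delta>>0. \<forall>D. subdivision a b D \<and> (\<Sum>(c, d)\<in>D. d - c) < \<delta> \<longrightarrow> var_sum var_fun D < \<epsilon>"
  proof (intro exI[of _ \<delta>] conjI allI impI)
    fix D assume D: "subdivision a b D \<and> (\<Sum>(c, d)\<in>D. d - c) < \<delta>"
    have "var_sum var_fun D = (\<Sum>(c, d)\<in>D. variation f c d)"
      unfolding var_sum_def
    proof (rule sum.cong)
      fix q assume "q \<in> D"
      then show "(case q of (c, d) \<Rightarrow> \<bar>var_fun d - var_fun c\<bar>) = (case q of (c, d) \<Rightarrow> variation f c d)"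
        using D var_fun_diff[of "fst q" "snd q"] variation_diff_le[of "fst q" "snd q"]
        by (auto simp: subdivision_def)
    qed simp
    also have "\<dots> \<le> \<epsilon> / 2"
      by (rule variation_sum_less[of a b D \<delta>]) (use D d(2) in \<open>auto simp: less_imp_le\<close>)
    finally show "var_sum var_fun D < \<epsilon>" using \<open>\<epsilon> > 0\<close> by simp
  qed fact
qed

end

section \<open>Lebesgue densities of absolutely continuous functions\<close>

text \<open>An open set of length below \<delta> contains the null set. Covering the null set by
  nonoverlapping compact intervals that lie both in this open set and in [a,b] makes every finite
  group of them have F-increments adding up to less than \<epsilon>, which bounds the
  measure.\<close>

lemma interval_measure_null:
  assumes ac: "loc_abs_cont_on UNIV F" and mono: "mono F"
    and N: "N \<in> null_sets lborel" and Nab: "N \<subseteq> {a..b}" and "a < b"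
  shows "emeasure (interval_measure F) N = 0"
proof -
  let ?\<mu> = "interval_measure F"
  have cont: "continuous_on UNIV F"
    by (rule loc_abs_cont_on_imp_continuous_on[OF ac]) simp
  note Icc = emeasure_interval_measure_Icc[OF _ monoD[OF mono] cont]
  have le: "emeasure ?\<mu> N \<le> ennreal \<epsilon>" if "\<epsilon> > 0" for \<epsilon>
  proof -
    have "abs_cont_on a b F" using ac \<open>a < b\<close> by (auto simp: loc_abs_cont_on_def)
    from abs_cont_onD[OF this \<open>\<epsilon> > 0\<close>] obtain \<delta> where d: "\<delta> > 0"
      "\<And>D. subdivision a b D \<Longrightarrow> (\<Sum>(c, d)\<in>D. d - c) < \<delta> \<Longrightarrow> var_sum F D < \<epsilon>"
      by metis
    have "N \<in> sets borel" using N by auto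
    from outer_regular_lborel[OF this \<open>\<delta> > 0\<close>] obtain U where
      U: "open U" "N \<subseteq> U" "emeasure lborel (U - N) < ennreal \<delta>" by metis
    have "emeasure lborel U = emeasure lborel (U - N)"
      using emeasure_Diff_null_set[of N lborel U] N U(1) by auto
    with U(3) have lU: "emeasure lborel U < ennreal \<delta>" by simp
    \<comment> \<open>Each covering interval has a tag in \<open>N\<close>, hence in
      \<open>U\<close>; this gauge therefore forces the interval to lie in \<open>U\<close>.\<close>
    define g where "g x = (if x \<in> U then U else UNIV)" for x
    have "gauge g" using U(1) by (auto simp: gauge_def g_def)
    have "N \<subseteq> cbox a b" "box a b \<noteq> {}" using Nab \<open>a < b\<close> by auto
    from covering_lemma[OF this \<open>gauge g\<close>] obtain C where C: "countable C" "\<Union>C \<subseteq> cbox a b"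
      "\<And>K. K \<in> C \<Longrightarrow> interior K \<noteq> {} \<and> (\<exists>c d. K = cbox c d)"
      "pairwise (\<lambda>A B. interior A \<inter> interior B = {}) C"
      "\<And>K. K \<in> C \<Longrightarrow> \<exists>x \<in> N \<inter> K. K \<subseteq> g x" "N \<subseteq> \<Union>C"
      by metis
    have CU: "K \<subseteq> U" if K: "K \<in> C" for K
    proof -
      obtain x where "x \<in> N" "K \<subseteq> g x" using C(5)[OF K] by blast
      then show ?thesis using U(2) by (auto simp: g_def split: if_splits)
    qed
    \<comment> \<open>Absolute continuity speaks of finite families only. The countable cover is
      reached afterwards, by continuity of the measure along increasing unions.\<close>
    have fin: "emeasure ?\<mu> (\<Union>\<F>) \<le> ennreal \<epsilon>" if "finite \<F>" "\<F> \<subseteq> C" for \<F>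
    proof -
      define D where "D = {(c, d). c < d \<and> {c..d} \<in> \<F>}"
      have F_eq: "\<F> = (\<lambda>(c, d). {c..d}) ` D"
      proof -
        have "K \<in> (\<lambda>(c, d). {c..d}) ` D" if K: "K \<in> \<F>" for K
        proof -
          have "K \<in> C" using \<open>\<F> \<subseteq> C\<close> K by blast
          then obtain c d where "K = cbox c d" "interior K \<noteq> {}" using C(3) by blast
          then have "K = {c..d}" "c < d" by auto
          with K \<open>K = {c..d}\<close> show ?thesis by (auto simp: D_def)
        qed
        then show ?thesis by (auto simp: D_def)
      qed
      have inj: "inj_on (\<lambda>(c, d). {c..d}) D"
        by (auto simp: inj_on_def D_def)
      have finD: "finite D"
        using \<open>finite \<F>\<close> inj unfolding F_eq by (rule finite_imageD)
      have sub: "subdivision a b D"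
        unfolding subdivision_def
      proof (intro conjI)
        show "\<forall>(c, d)\<in>D. a \<le> c \<and> c < d \<and> d \<le> b"
        proof safe
          fix c d assume "(c, d) \<in> D"
          then have cd: "{c..d} \<in> C" "c < d" using \<open>\<F> \<subseteq> C\<close> by (auto simp: D_def)
          have "{c..d} \<subseteq> \<Union>C" using cd(1) by (rule Union_upper)
          also have "\<dots> \<subseteq> {a..b}" using C(2) by simp
          finally have "{c..d} \<subseteq> {a..b}" .
          with cd(2) show "a \<le> c" "c < d" "d \<le> b" by auto
        qed
        show "disjoint_family_on (\<lambda>(c, d). {c<..<d}) D"
          unfolding disjoint_family_on_def
        proof (intro ballI impI)
          fix q q' assume q: "q \<in> D" "q' \<in> D" "q \<noteq> q'"
          obtain c d c' d' where [simp]: "q = (c, d)" "q' = (c', d')" by (cases q, cases q')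
          have "{c..d} \<noteq> {c'..d'}"
          proof
            assume "{c..d} = {c'..d'}"
            then have "(\<lambda>(c, d). {c..d}) q = (\<lambda>(c, d). {c..d}) q'" by simp
            from inj_onD[OF inj this q(1,2)] q(3) show False by simp
          qed
          moreover have "{c..d} \<in> C" "{c'..d'} \<in> C" using q \<open>\<F> \<subseteq> C\<close> by (auto simp: D_def)
          ultimately have "interior {c..d} \<inter> interior {c'..d'} = {}"
            using pairwiseD[OF C(4)] by blast
          then show "(\<lambda>(c, d). {c<..<d}) q \<inter> (\<lambda>(c, d). {c<..<d}) q' = {}"
            by simp
        qed
      qed fact
      have "(\<Union>(c, d)\<in>D. {c<..<d}) \<subseteq> U"
      proof safe
        fix c d x assume "(c, d) \<in> D" "x \<in> {c<..<d}"
        then have "{c..d} \<subseteq> U" "x \<in> {c..d}" using CU \<open>\<F> \<subseteq> C\<close> by (auto simp: D_def)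
        then show "x \<in> U" by blast
      qed
      from subdivision_length_le_emeasure[OF sub this] U(1)
      have "ennreal (\<Sum>(c, d)\<in>D. d - c) \<le> emeasure lborel U" by simp
      also note lU
      finally have "(\<Sum>(c, d)\<in>D. d - c) < \<delta>"
        using \<open>\<delta> > 0\<close> by (simp add: ennreal_less_iff ennreal_lessI less_le_trans
            split: if_splits) (meson ennreal_leI linorder_not_le)
      from d(2)[OF sub this] have less: "var_sum F D < \<epsilon>" .
      have "emeasure ?\<mu> (\<Union>\<F>) = emeasure ?\<mu> (\<Union>q\<in>D. (\<lambda>(c, d). {c..d}) q)"
        unfolding F_eq ..
      also have "\<dots> \<le> (\<Sum>q\<in>D. emeasure ?\<mu> (case q of (c, d) \<Rightarrow> {c..d}))"
        by (rule emeasure_subadditive_finite) (use finD in auto)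
      also have "\<dots> = (\<Sum>q\<in>D. ennreal (case q of (c, d) \<Rightarrow> \<bar>F d - F c\<bar>))"
        by (rule sum.cong) (auto simp: D_def Icc monoD[OF mono])
      also have "\<dots> = ennreal (var_sum F D)"
        unfolding var_sum_def by (rule sum_ennreal) auto
      also have "\<dots> \<le> ennreal \<epsilon>" using less by (simp add: ennreal_leI)
      finally show ?thesis .
    qed
    show ?thesis
    proof (cases "C = {}")
      case True with C(6) show ?thesis by simp
    next
      case False
      \<comment> \<open>If \<open>C\<close> is finite the enumeration repeats members, which is
        harmless for unions.\<close>
      define A where "A n = \<Union>(from_nat_into C ` {..<n})" for n :: nat
      have sets: "K \<in> sets borel" if "K \<in> C" for K using C(3)[OF that] by auto
      have UA: "(\<Union>n. A n) = \<Union>C"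
      proof -
        have "(\<Union>n. A n) = \<Union>(range (from_nat_into C))"
          unfolding A_def by (auto intro: lessI)
        then show ?thesis using range_from_nat_into[OF False C(1)] by simp
      qed
      have rA: "range A \<subseteq> sets ?\<mu>"
        using from_nat_into[OF False] sets by (auto simp: A_def)
      have "incseq A" by (force simp: incseq_def A_def)
      have "emeasure ?\<mu> N \<le> emeasure ?\<mu> (\<Union>n. A n)"
      proof (rule emeasure_mono)
        show "N \<subseteq> (\<Union>n. A n)" using C(6) UA by simp
        show "(\<Union>n. A n) \<in> sets ?\<mu>" using rA by blast
      qed
      also have "\<dots> = (SUP n. emeasure ?\<mu> (A n))"
        using SUP_emeasure_incseq[OF rA \<open>incseq A\<close>] by simp
      also have "\<dots> \<le> ennreal \<epsilon>"
        unfolding A_def by (intro SUP_least fin) (use from_nat_into[OF False] in auto)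
      finally show ?thesis .
    qed
  qed
  have "emeasure ?\<mu> N \<le> 0"
  proof (rule ennreal_le_epsilon)
    fix \<epsilon> :: real assume "\<epsilon> > 0"
    then show "emeasure ?\<mu> N \<le> 0 + ennreal \<epsilon>" using le by simp
  qed
  then show ?thesis by simp
qed

text \<open>A finite integral forces finite values almost everywhere on the set, so
  \<open>enn2real\<close> discards only a null set of infinite values.\<close>

lemma set_integral_enn2real:
  assumes f[measurable]: "f \<in> borel_measurable M" and A[measurable]: "A \<in> sets M"
    and fin: "(\<integral>\<^sup>+t\<in>A. f t \<partial>M) < \<infinity>"
  shows "set_integrable M A (\<lambda>t. enn2real (f t))"
    and "(LINT t:A|M. enn2real (f t)) = enn2real (\<integral>\<^sup>+t\<in>A. f t \<partial>M)"
proof -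
  have "AE t in M. f t * indicator A t \<noteq> \<infinity>"
    using fin by (intro nn_integral_noteq_infinite) auto
  then have "(\<integral>\<^sup>+t. ennreal (indicator A t *\<^sub>R enn2real (f t)) \<partial>M) = (\<integral>\<^sup>+t\<in>A. f t \<partial>M)"
    by (intro nn_integral_cong_AE, eventually_elim) (auto simp: indicator_def less_top)
  also have "\<dots> = ennreal (enn2real (\<integral>\<^sup>+t\<in>A. f t \<partial>M))"
    using fin by simp
  finally have "integrable M (\<lambda>t. indicator A t *\<^sub>R enn2real (f t)) \<and>
      (\<integral>t. indicator A t *\<^sub>R enn2real (f t) \<partial>M) = enn2real (\<integral>\<^sup>+t\<in>A. f t \<partial>M)"
    by (subst (asm) nn_integral_eq_integrable) auto
  then show "set_integrable M A (\<lambda>t. enn2real (f t))"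
    and "(LINT t:A|M. enn2real (f t)) = enn2real (\<integral>\<^sup>+t\<in>A. f t \<partial>M)"
    by (auto simp: set_integrable_def set_lebesgue_integral_def)
qed

lemma mono_abs_cont_density:
  assumes ac: "loc_abs_cont_on UNIV F" and mono: "mono F"
  obtains H :: "real \<Rightarrow> real" where "H \<in> borel_measurable borel"
    "\<And>x y. x \<le> y \<Longrightarrow> set_integrable lborel {x..y} H"
    "\<And>x y. x \<le> y \<Longrightarrow> (LINT t:{x..y}|lborel. H t) = F y - F x"
proof -
  let ?\<mu> = "interval_measure F"
  have cont: "continuous_on UNIV F"
    by (rule loc_abs_cont_on_imp_continuous_on[OF ac]) simp
  note Icc = emeasure_interval_measure_Icc[OF _ monoD[OF mono] cont]
  have "absolutely_continuous lborel ?\<mu>"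
    unfolding absolutely_continuous_def
  proof
    fix N :: "real set" assume N: "N \<in> null_sets lborel"
    \<comment> \<open>The null-set lemma is for bounded sets, so \<open>N\<close> is exhausted by
      bounded pieces; \<open>Suc n\<close> keeps the bounding interval nondegenerate.\<close>
    have "(\<Union>n. N \<inter> {- real (Suc n)..real (Suc n)}) \<in> null_sets ?\<mu>"
    proof (rule null_sets_UN')
      fix n
      have "N \<inter> {- real (Suc n)..real (Suc n)} \<in> null_sets lborel"
        using N by (auto intro: null_set_Int2)
      from interval_measure_null[OF ac mono this, of "- real (Suc n)" "real (Suc n)"] null_setsD2[OF N]
      show "N \<inter> {- real (Suc n)..real (Suc n)} \<in> null_sets ?\<mu>" by (intro null_setsI) auto
    qed simp
    also have "(\<Union>n. N \<inter> {- real (Suc n)..real (Suc n)}) = N"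
    proof -
      have "\<exists>n. x \<in> {- real (Suc n)..real (Suc n)}" for x :: real
      proof -
        obtain n where "\<bar>x\<bar> \<le> real n" using real_arch_simple by blast
        then show ?thesis by (intro exI[of _ n]) auto
      qed
      then show ?thesis by blast
    qed
    finally show "N \<in> null_sets ?\<mu>" .
  qed
  then obtain H0 where H0: "H0 \<in> borel_measurable lborel" "density lborel H0 = ?\<mu>"
    using sigma_finite_measure.Radon_Nikodym[OF sigma_finite_lborel, of ?\<mu>] by auto
  have H0_int: "(\<integral>\<^sup>+t\<in>{x..y}. H0 t \<partial>lborel) = ennreal (F y - F x)" if "x \<le> y" for x y
    using Icc[OF that] emeasure_density[OF H0(1), of "{x..y}"] H0(2) by simp
  have m: "H0 \<in> borel_measurable lborel" and fin: "(\<integral>\<^sup>+t\<in>{x..y}. H0 t \<partial>lborel) < \<infinity>"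
    if "x \<le> y" for x y
    using H0(1) H0_int[OF that] by simp_all
  show ?thesis
  proof (rule that[of "\<lambda>t. enn2real (H0 t)"])
    show "(\<lambda>t. enn2real (H0 t)) \<in> borel_measurable borel" using H0(1) by simp
    show "set_integrable lborel {x..y} (\<lambda>t. enn2real (H0 t))" if "x \<le> y" for x y
      by (rule set_integral_enn2real(1)[OF m[OF that] _ fin[OF that]]) simp
    show "(LINT t:{x..y}|lborel. enn2real (H0 t)) = F y - F x" if "x \<le> y" for x y
      using set_integral_enn2real(2)[OF m[OF that] _ fin[OF that]] H0_int[OF that] monoD[OF mono that]
      by simp
  qed
qed

text \<open>The densities of the two monotone parts of the Jordan decomposition are
  subtracted.\<close>

lemma abs_cont_density:
  assumes ac: "loc_abs_cont_on UNIV f"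
  obtains G :: "real \<Rightarrow> real" where "G \<in> borel_measurable borel"
    "\<And>x y. x \<le> y \<Longrightarrow> set_integrable lborel {x..y} G"
    "\<And>x y. x \<le> y \<Longrightarrow> (LINT t:{x..y}|lborel. G t) = f y - f x"
proof -
  have ac1: "loc_abs_cont_on UNIV (var_fun f)"
    using abs_cont_on_var_fun[OF ac] by (auto simp: loc_abs_cont_on_def)
  have ac2: "loc_abs_cont_on UNIV (\<lambda>x. var_fun f x - f x)"
    using abs_cont_on_diff ac1 ac by (auto simp: loc_abs_cont_on_def)
  obtain H1 where H1: "H1 \<in> borel_measurable borel"
    "\<And>x y. x \<le> y \<Longrightarrow> set_integrable lborel {x..y} H1"
    "\<And>x y. x \<le> y \<Longrightarrow> (LINT t:{x..y}|lborel. H1 t) = var_fun f y - var_fun f x"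
    using mono_abs_cont_density[OF ac1 mono_var_fun[OF ac]] by metis
  obtain H2 where H2: "H2 \<in> borel_measurable borel"
    "\<And>x y. x \<le> y \<Longrightarrow> set_integrable lborel {x..y} H2"
    "\<And>x y. x \<le> y \<Longrightarrow> (LINT t:{x..y}|lborel. H2 t) = (var_fun f y - f y) - (var_fun f x - f x)"
    using mono_abs_cont_density[OF ac2 mono_var_fun_diff[OF ac]] by metis
  show ?thesis
    by (rule that[of "\<lambda>t. H1 t - H2 t"])
      (use H1 H2 in \<open>auto intro: set_integral_diff simp: set_integral_diff\<close>)
qed

text \<open>Lebesgue differentiation is available here for averages over [x, x+h] with h > 0, which
  controls right difference quotients. Left quotients at x are right averages of the reflected
  function at -x, so the exceptional set is \<open>N1\<close> together with the reflection of
  \<open>N2\<close>.\<close>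

lemma indefinite_integral_AE_deriv:
  fixes f G :: "real \<Rightarrow> real"
  assumes G: "\<And>x y. x \<le> y \<Longrightarrow> set_integrable lborel {x..y} G"
    "\<And>x y. x \<le> y \<Longrightarrow> (LINT t:{x..y}|lborel. G t) = f y - f x"
  shows "AE x in lborel. (f has_field_derivative G x) (at x)"
proof -
  have G'1: "G integrable_on {x..y}" for x y
  proof (cases "x \<le> y")
    case True
    then show ?thesis by (rule set_borel_integral_eq_integral(1)[OF G(1)])
  next
    case False
    then have "{x..y} = {}" by simp
    then show ?thesis by (simp add: integrable_on_empty)
  qed
  have G'2: "integral {x..y} G = f y - f x" if "x \<le> y" for x y
    using set_borel_integral_eq_integral(2)[OF G(1)[OF that]] G(2)[OF that] by simp
  have i1: "G integrable_on cbox x y" for x y using G'1 by simp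
  have i2: "(\<lambda>t. G (- t)) integrable_on cbox x y" for x y
    using Henstock_Kurzweil_Integration.integrable_reflect_real[where f = G and a = "- y" and b = "- x"] G'1[of "-y" "-x"] by simp
  obtain N1 where N1: "negligible N1"
    "\<And>x e. \<lbrakk>x \<notin> N1; 0 < e\<rbrakk> \<Longrightarrow> \<exists>d>0. \<forall>h. 0 < h \<and> h < d \<longrightarrow>
       norm (integral (cbox x (x + h *\<^sub>R One)) G /\<^sub>R h ^ DIM(real) - G x) < e"
    using integrable_ccontinuous_explicit[of G, OF i1] by metis
  obtain N2 where N2: "negligible N2"
    "\<And>x e. \<lbrakk>x \<notin> N2; 0 < e\<rbrakk> \<Longrightarrow> \<exists>d>0. \<forall>h. 0 < h \<and> h < d \<longrightarrow>
       norm (integral (cbox x (x + h *\<^sub>R One)) (\<lambda>t. G (- t)) /\<^sub>R h ^ DIM(real) - G (- x)) < e"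
    using integrable_ccontinuous_explicit[of "\<lambda>t. G (- t)", OF i2] by metis
  have deriv: "(f has_field_derivative G x) (at x)" if x: "x \<notin> N1" "- x \<notin> N2" for x
    unfolding DERIV_def LIM_eq
  proof (intro allI impI)
    fix e :: real assume "e > 0"
    obtain d1 where d1: "d1 > 0" "\<And>h. 0 < h \<Longrightarrow> h < d1 \<Longrightarrow> \<bar>integral {x..x + h} G / h - G x\<bar> < e"
      using N1(2)[OF x(1) \<open>e > 0\<close>] by (auto simp: field_simps)
    obtain d2 where d2: "d2 > 0" "\<And>h. 0 < h \<Longrightarrow> h < d2 \<Longrightarrow>
        \<bar>integral {- x..- (x - h)} (\<lambda>t. G (- t)) / h - G x\<bar> < e"
      using N2(2)[OF x(2) \<open>e > 0\<close>] by (auto simp: field_simps)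
    show "\<exists>s>0. \<forall>h. h \<noteq> 0 \<and> norm (h - 0) < s \<longrightarrow> norm ((f (x + h) - f x) / h - G x) < e"
    proof (intro exI[of _ "min d1 d2"] conjI allI impI)
      fix h :: real assume h: "h \<noteq> 0 \<and> norm (h - 0) < min d1 d2"
      show "norm ((f (x + h) - f x) / h - G x) < e"
      proof (cases "h > 0")
        case True
        with d1(2)[of h] h G'2[of x "x + h"] show ?thesis by simp
      next
        case False
        then have neg: "0 < - h" "- h < d2" using h by auto
        have eq: "integral {- x..- (x - (- h))} (\<lambda>t. G (- t)) = f x - f (x + h)"
          using G'2[of "x + h" x] Henstock_Kurzweil_Integration.integral_reflect_real[of x "x + h" G] neg
          by simp
        have "(f x - f (x + h)) / (- h) = (f (x + h) - f x) / h"
          by (metis minus_diff_eq minus_divide_divide)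
        with d2(2)[OF neg] show ?thesis unfolding eq by simp
      qed
    qed (use d1 d2 in auto)
  qed
  have "negligible (uminus ` N2)"
    by (rule negligible_differentiable_image_negligible[OF order_refl N2(1)])
      (auto intro!: derivative_intros simp: differentiable_on_def)
  then have "N1 \<union> uminus ` N2 \<in> null_sets lebesgue"
    using N1(1) by (simp add: negligible_iff_null_sets[symmetric])
  then have "AE x in lebesgue. (f has_field_derivative G x) (at x)"
  proof (rule AE_I')
    show "{x \<in> space lebesgue. \<not> (f has_field_derivative G x) (at x)} \<subseteq> N1 \<union> uminus ` N2"
    proof
      fix x assume "x \<in> {x \<in> space lebesgue. \<not> (f has_field_derivative G x) (at x)}"
      with deriv[of x] have "x \<in> N1 \<or> - x \<in> N2" by auto
      then show "x \<in> N1 \<union> uminus ` N2" by (metis UnI1 UnI2 add.inverse_inverse image_eqI)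
    qed
  qed
  then show ?thesis by (simp add: AE_completion_iff)
qed

text \<open>\<open>G\<close> is the Borel stand-in for \<open>deriv f\<close> in all later
  integrals.\<close>

lemma abs_cont_FTC:
  assumes ac: "loc_abs_cont_on UNIV f"
  obtains G :: "real \<Rightarrow> real" where "G \<in> borel_measurable borel"
    "AE x in lborel. deriv f x = G x"
    "\<And>x y. x \<le> y \<Longrightarrow> set_integrable lborel {x..y} G"
    "\<And>x y. x \<le> y \<Longrightarrow> (LINT t:{x..y}|lborel. G t) = f y - f x"
proof -
  obtain G where G: "G \<in> borel_measurable borel"
    "\<And>x y. x \<le> y \<Longrightarrow> set_integrable lborel {x..y} G"
    "\<And>x y. x \<le> y \<Longrightarrow> (LINT t:{x..y}|lborel. G t) = f y - f x"
    using abs_cont_density[OF ac] by metis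
  have "AE x in lborel. deriv f x = G x"
    using indefinite_integral_AE_deriv[of G f] G(2,3) by (auto dest: DERIV_imp_deriv elim: eventually_mono)
  then show ?thesis using that[of G] G by blast
qed

subsection \<open>Expectations and weighted kernels\<close>

text \<open>Changing a function on a null set preserves measurability only for a complete measure.
  This admits integrands containing \<open>deriv g\<close>.\<close>

lemma borel_measurable_completion_cong_AE:
  fixes f g :: "'a \<Rightarrow> real"
  assumes g: "g \<in> borel_measurable (completion M)" and ae: "AE x in M. f x = g x"
  shows "f \<in> borel_measurable (completion M)"
proof (rule measurableI)
  fix A :: "real set" assume A: "A \<in> sets borel"
  show "f -` A \<inter> space (completion M) \<in> sets (completion M)"
  proof (rule completion.in_sets_AE)
    show "g -` A \<inter> space (completion M) \<in> sets (completion M)"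
      using g A by (rule measurable_sets)
    show "AE x in completion M. x \<in> g -` A \<inter> space (completion M) \<longleftrightarrow> x \<in> f -` A \<inter> space (completion M)"
      using AE_completion[OF ae] by eventually_elim auto
  qed auto
qed auto

text \<open>\<phi> need not be Borel; it is enough that p \<phi> agrees almost everywhere with a
  Borel function, because Z almost surely avoids Lebesgue null sets and the zeros of p.\<close>

lemma expect_lborel:
  assumes D: "distributed \<Omega> lborel Z (\<lambda>x. ennreal (p x))" and nn: "\<And>x. 0 \<le> p x"
    and \<psi>[measurable]: "\<psi> \<in> borel_measurable borel" and eq: "AE v in lborel. p v * \<phi> v = \<psi> v"
  shows "expect_finite \<Omega> Z \<phi> \<longleftrightarrow> integrable lborel \<psi>"
    and "expect \<Omega> Z \<phi> = (\<integral>v. \<psi> v \<partial>lborel)"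
proof -
  have [measurable]: "p \<in> borel_measurable borel"
    using distributed_real_measurable[of lborel p, OF _ D] nn by simp
  have [measurable]: "Z \<in> borel_measurable \<Omega>"
    using distributed_measurable[OF D] by simp
  \<comment> \<open>A Borel version of \<phi>. Where p vanishes the quotient is 0 by convention, and
    Z is almost surely elsewhere.\<close>
  define \<phi>0 where "\<phi>0 v = \<psi> v / p v" for v
  have \<phi>0[measurable]: "\<phi>0 \<in> borel_measurable borel" unfolding \<phi>0_def by measurable
  from eq obtain N where N': "{v \<in> space lborel. p v * \<phi> v \<noteq> \<psi> v} \<subseteq> N"
    "emeasure lborel N = 0" "N \<in> sets lborel"
    by (rule AE_E)
  then have N: "N \<in> null_sets lborel" by (intro null_setsI)
  have "AE \<omega> in distr \<Omega> lborel Z. \<omega> \<notin> N \<and> 0 < p \<omega>"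
    unfolding distributed_distr_eq_density[OF D]
  proof (subst AE_density)
    show "AE v in lborel. 0 < ennreal (p v) \<longrightarrow> v \<notin> N \<and> 0 < p v"
      using AE_not_in[OF N] by eventually_elim simp
  qed measurable
  then have "AE \<omega> in \<Omega>. Z \<omega> \<notin> N \<and> 0 < p (Z \<omega>)"
    by (rule AE_distrD[rotated]) measurable
  then have ae: "AE \<omega> in \<Omega>. \<phi> (Z \<omega>) = \<phi>0 (Z \<omega>)"
  proof eventually_elim
    case (elim \<omega>)
    then have "p (Z \<omega>) * \<phi> (Z \<omega>) = \<psi> (Z \<omega>)" using N'(1) by auto
    then show ?case using elim by (auto simp: \<phi>0_def field_simps)
  qed
  have m0: "(\<lambda>\<omega>. \<phi>0 (Z \<omega>)) \<in> borel_measurable (completion \<Omega>)"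
    by (rule measurable_completion) measurable
  have m: "(\<lambda>\<omega>. \<phi> (Z \<omega>)) \<in> borel_measurable (completion \<Omega>)"
    by (rule borel_measurable_completion_cong_AE[OF m0 ae])
  have ae2: "AE v in lborel. p v * \<phi>0 v = \<psi> v"
    using eq by eventually_elim (auto simp: \<phi>0_def)
  have "expect_finite \<Omega> Z \<phi> \<longleftrightarrow> integrable (completion \<Omega>) (\<lambda>\<omega>. \<phi>0 (Z \<omega>))"
    unfolding expect_finite_def by (rule integrable_cong_AE[OF m m0 AE_completion[OF ae]])
  also have "\<dots> \<longleftrightarrow> integrable \<Omega> (\<lambda>\<omega>. \<phi>0 (Z \<omega>))"
    by (rule integrable_completion) measurable
  also have "\<dots> \<longleftrightarrow> integrable lborel (\<lambda>v. p v * \<phi>0 v)"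
    by (rule distributed_integrable[OF D, symmetric]) (use nn in auto)
  also have "\<dots> \<longleftrightarrow> integrable lborel \<psi>"
    by (rule integrable_cong_AE[OF _ _ ae2]) auto
  finally show "expect_finite \<Omega> Z \<phi> \<longleftrightarrow> integrable lborel \<psi>" .
  have "expect \<Omega> Z \<phi> = (\<integral>\<omega>. \<phi>0 (Z \<omega>) \<partial>completion \<Omega>)"
    unfolding expect_def by (rule integral_cong_AE[OF m m0 AE_completion[OF ae]])
  also have "\<dots> = (\<integral>\<omega>. \<phi>0 (Z \<omega>) \<partial>\<Omega>)"
    by (rule integral_completion) measurable
  also have "\<dots> = (\<integral>v. p v * \<phi>0 v \<partial>lborel)"
    by (rule distributed_integral[OF D, symmetric]) (use nn in auto)
  also have "\<dots> = (\<integral>v. \<psi> v \<partial>lborel)"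
    by (rule integral_cong_AE[OF _ _ ae2]) auto
  finally show "expect \<Omega> Z \<phi> = (\<integral>v. \<psi> v \<partial>lborel)" .
qed

text \<open>As q is nonnegative, integrating the absolute value of the integrand over t gives |G s|
  W s. The single assumption on W G therefore yields integrability on the product, and with it the
  exchange of integrals.\<close>

lemma Fubini_weighted_kernel:
  fixes q G W :: "real \<Rightarrow> real" and R :: "(real \<times> real) set"
  assumes [measurable]: "q \<in> borel_measurable borel" "G \<in> borel_measurable borel"
      "R \<in> sets (borel \<Otimes>\<^sub>M borel)"
    and nn: "\<And>t. 0 \<le> q t"
    and W: "\<And>s. integrable lborel (\<lambda>t. indicator R (t, s) * q t)"
      "\<And>s. (\<integral>t. indicator R (t, s) * q t \<partial>lborel) = W s"
    and int: "integrable lborel (\<lambda>s. W s * G s)"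
  shows "integrable lborel (\<lambda>t. q t * (\<integral>s. indicator R (t, s) * G s \<partial>lborel))"
    and "(\<integral>t. q t * (\<integral>s. indicator R (t, s) * G s \<partial>lborel) \<partial>lborel) = (\<integral>s. W s * G s \<partial>lborel)"
proof -
  define F where "F = (\<lambda>(s, t). G s * (indicator R (t, s) * q t))"
  have F[measurable]: "F \<in> borel_measurable (lborel \<Otimes>\<^sub>M lborel)"
    unfolding F_def by measurable
  have abs: "(\<integral>t. norm (F (s, t)) \<partial>lborel) = \<bar>G s\<bar> * W s" for s
    unfolding F_def W(2)[symmetric] using nn by (simp add: abs_mult)
  have W_nn: "0 \<le> W s" for s
    unfolding W(2)[symmetric] using nn by (intro integral_nonneg_AE) auto
  have "integrable lborel (\<lambda>s. \<integral>t. norm (F (s, t)) \<partial>lborel)"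
    unfolding abs using integrable_abs[OF int] W_nn by (simp add: abs_mult mult.commute)
  then have intF: "integrable (lborel \<Otimes>\<^sub>M lborel) F"
    using W(1) by (intro lborel_pair.Fubini_integrable) (auto simp: F_def intro!: always_eventually)
  have e: "(\<integral>s. F (s, t) \<partial>lborel) = q t * (\<integral>s. indicator R (t, s) * G s \<partial>lborel)" for t
    unfolding F_def by (subst integral_mult_right_zero[symmetric]) (simp add: mult_ac)
  show "integrable lborel (\<lambda>t. q t * (\<integral>s. indicator R (t, s) * G s \<partial>lborel))"
    using lborel_pair.integrable_snd[of "\<lambda>s t. F (s, t)"] intF by (simp add: e)
  have "(\<integral>t. q t * (\<integral>s. indicator R (t, s) * G s \<partial>lborel) \<partial>lborel) = (\<integral>t. \<integral>s. F (s, t) \<partial>lborel \<partial>lborel)"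
    by (simp add: e)
  also have "\<dots> = (\<integral>s. \<integral>t. F (s, t) \<partial>lborel \<partial>lborel)"
    using lborel_pair.Fubini_integral[of "\<lambda>s t. F (s, t)"] intF by simp
  also have "\<dots> = (\<integral>s. W s * G s \<partial>lborel)"
    unfolding F_def prod.case integral_mult_right_zero W(2) by (simp add: mult.commute)
  finally show "(\<integral>t. q t * (\<integral>s. indicator R (t, s) * G s \<partial>lborel) \<partial>lborel) = (\<integral>s. W s * G s \<partial>lborel)" .
qed

section \<open>Iterated integrals of the density and integration by parts\<close>

abbreviation lower_ray :: "ereal \<Rightarrow> real \<Rightarrow> real set" where
  "lower_ray l x \<equiv> {t. l < ereal t \<and> t \<le> x}"

abbreviation upper_ray :: "ereal \<Rightarrow> real \<Rightarrow> real set" where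
  "upper_ray u x \<equiv> {t. x \<le> t \<and> ereal t < u}"

text \<open>Infinite values become 0 here, so statements about integrals of these functions carry a
  finiteness assumption on the \<open>ennreal\<close> version.\<close>

abbreviation PL :: "(real \<Rightarrow> real) \<Rightarrow> ereal \<Rightarrow> nat \<Rightarrow> real \<Rightarrow> real" where
  "PL p l j t \<equiv> enn2real (P_lower p l j t)"

abbreviation PU :: "(real \<Rightarrow> real) \<Rightarrow> ereal \<Rightarrow> nat \<Rightarrow> real \<Rightarrow> real" where
  "PU p u j t \<equiv> enn2real (P_upper p u j t)"

lemma P_lower_measurable [measurable]:
  assumes [measurable]: "p \<in> borel_measurable borel"
  shows "P_lower p l j \<in> borel_measurable borel"
proof (induction j)
  case 0
  have "P_lower p l 0 = (\<lambda>x. ennreal (p x))" by auto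
  then show ?case by simp
next
  case (Suc j)
  note Suc[measurable]
  have "P_lower p l (Suc j) = (\<lambda>x. \<integral>\<^sup>+t. P_lower p l j t *
      indicator {z\<in>space (borel \<Otimes>\<^sub>M lborel). l < ereal (snd z) \<and> snd z \<le> fst z} (x, t) \<partial>lborel)"
    by (auto intro!: ext nn_integral_cong simp: indicator_def space_pair_measure)
  also have "\<dots> \<in> borel_measurable borel" by measurable
  finally show ?case .
qed

lemma P_upper_measurable [measurable]:
  assumes [measurable]: "p \<in> borel_measurable borel"
  shows "P_upper p u j \<in> borel_measurable borel"
proof (induction j)
  case 0
  have "P_upper p u 0 = (\<lambda>x. ennreal (p x))" by auto
  then show ?case by simp
next
  case (Suc j)
  note Suc[measurable]
  have "P_upper p u (Suc j) = (\<lambda>x. \<integral>\<^sup>+t. P_upper p u j t *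
      indicator {z\<in>space (borel \<Otimes>\<^sub>M lborel). fst z \<le> snd z \<and> ereal (snd z) < u} (x, t) \<partial>lborel)"
    by (auto intro!: ext nn_integral_cong simp: indicator_def space_pair_measure)
  also have "\<dots> \<in> borel_measurable borel" by measurable
  finally show ?case .
qed

text \<open>The iterated integral is monotone in its endpoint, so finiteness at x covers all s to
  the left of it.\<close>

lemma P_lower_integral:
  assumes [measurable]: "p \<in> borel_measurable borel" and "P_lower p l (Suc j) x < \<infinity>" and "s \<le> x"
  shows "set_integrable lborel (lower_ray l s) (PL p l j)"
    and "(LINT t:lower_ray l s|lborel. PL p l j t) = PL p l (Suc j) s"
proof -
  have "P_lower p l (Suc j) s \<le> P_lower p l (Suc j) x"
    using \<open>s \<le> x\<close> by (auto intro!: nn_integral_mono simp: indicator_def)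
  with assms(2) have "(\<integral>\<^sup>+t\<in>lower_ray l s. P_lower p l j t \<partial>lborel) < \<infinity>"
    by (auto intro: le_less_trans)
  from set_integral_enn2real[OF _ _ this]
  show "set_integrable lborel (lower_ray l s) (PL p l j)"
    "(LINT t:lower_ray l s|lborel. PL p l j t) = PL p l (Suc j) s" by auto
qed

lemma P_upper_integral:
  assumes [measurable]: "p \<in> borel_measurable borel" and "P_upper p u (Suc j) x < \<infinity>" and "x \<le> s"
  shows "set_integrable lborel (upper_ray u s) (PU p u j)"
    and "(LINT t:upper_ray u s|lborel. PU p u j t) = PU p u (Suc j) s"
proof -
  have "P_upper p u (Suc j) s \<le> P_upper p u (Suc j) x"
    using \<open>x \<le> s\<close> by (auto intro!: nn_integral_mono simp: indicator_def)
  with assms(2) have "(\<integral>\<^sup>+t\<in>upper_ray u s. P_upper p u j t \<partial>lborel) < \<infinity>"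
    by (auto intro: le_less_trans)
  from set_integral_enn2real[OF _ _ this]
  show "set_integrable lborel (upper_ray u s) (PU p u j)"
    "(LINT t:upper_ray u s|lborel. PU p u j t) = PU p u (Suc j) s" by auto
qed

text \<open>The difference g x - g t is the integral of \<open>G\<close> over [t,x]; exchanging the
  order moves one integration from \<open>G\<close> to the density. Integrability against g is an
  outcome of the exchange.\<close>

lemma by_parts_lower:
  assumes [measurable]: "p \<in> borel_measurable borel" "G \<in> borel_measurable borel"
    and G: "\<And>a b. a \<le> b \<Longrightarrow> (LINT t:{a..b}|lborel. G t) = g b - g a"
    and fin: "P_lower p l (Suc j) x < \<infinity>"
    and int: "set_integrable lborel (lower_ray l x) (\<lambda>s. PL p l (Suc j) s * G s)"
  shows "set_integrable lborel (lower_ray l x) (\<lambda>t. PL p l j t * g t)"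
    and "(LINT t:lower_ray l x|lborel. PL p l j t * g t) =
      g x * PL p l (Suc j) x - (LINT s:lower_ray l x|lborel. PL p l (Suc j) s * G s)"
proof -
  define R where "R = {z\<in>space (borel \<Otimes>\<^sub>M borel). l < ereal (fst z) \<and> fst z \<le> snd z \<and> snd z \<le> x}"
  define W where "W s = indicator {..x} s * PL p l (Suc j) s" for s
  have R[measurable]: "R \<in> sets (borel \<Otimes>\<^sub>M borel)" unfolding R_def by measurable
  have R_eq: "(indicator R (t, s) :: real) = indicator {..x} s * indicator (lower_ray l s) t" for t s
    by (auto simp: R_def indicator_def space_pair_measure)
  have W: "integrable lborel (\<lambda>t. indicator R (t, s) * PL p l j t)"
    "(\<integral>t. indicator R (t, s) * PL p l j t \<partial>lborel) = W s" for s
  proof -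
    have "integrable lborel (\<lambda>t. indicator R (t, s) * PL p l j t) \<and>
        (\<integral>t. indicator R (t, s) * PL p l j t \<partial>lborel) = W s"
    proof (cases "s \<le> x")
      case True
      with P_lower_integral[OF assms(1) fin True] show ?thesis
        by (simp add: R_eq W_def set_integrable_def set_lebesgue_integral_def)
    qed (simp add: R_eq W_def)
    then show "integrable lborel (\<lambda>t. indicator R (t, s) * PL p l j t)"
      "(\<integral>t. indicator R (t, s) * PL p l j t \<partial>lborel) = W s" by auto
  qed
  \<comment> \<open>When s does not exceed l the ray is empty and \<open>PL p l (Suc j) s\<close> is
    0, so the condition l < s may be added freely.\<close>
  have W_eq: "W s * G s = indicator (lower_ray l x) s *\<^sub>R (PL p l (Suc j) s * G s)" for s
  proof (cases "l < ereal s")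
    case False
    then have "lower_ray l s = {}" by (auto intro: less_le_trans)
    then have "PL p l (Suc j) s = 0" by (simp only: P_lower.simps) simp
    then show ?thesis by (simp only: W_def) simp
  qed (auto simp: W_def indicator_def)
  have inner: "(\<integral>s. indicator R (t, s) * G s \<partial>lborel) = indicator (lower_ray l x) t * (g x - g t)" for t
  proof (cases "t \<in> lower_ray l x")
    case True
    then have "(\<integral>s. indicator R (t, s) * G s \<partial>lborel) = (LINT s:{t..x}|lborel. G s)"
      unfolding set_lebesgue_integral_def
      by (intro Bochner_Integration.integral_cong) (auto simp: R_def indicator_def space_pair_measure)
    with G[of t x] True show ?thesis by simp
  next
    case False
    then have "(t, s) \<notin> R" for s
      by (auto simp: R_def)
    with False show ?thesis by simp
  qed
  have "integrable lborel (\<lambda>s. W s * G s)"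
    using int unfolding W_eq set_integrable_def .
  note F = Fubini_weighted_kernel[OF _ _ R _ W this, unfolded inner]
  have int1: "set_integrable lborel (lower_ray l x) (\<lambda>t. PL p l j t * (g x - g t))"
    using F(1) by (simp add: set_integrable_def mult_ac)
  have int2: "set_integrable lborel (lower_ray l x) (\<lambda>t. g x * PL p l j t)"
    using P_lower_integral(1)[OF assms(1) fin order_refl] by (rule set_integrable_mult_right)
  have eq: "PL p l j t * g t = g x * PL p l j t - PL p l j t * (g x - g t)" for t
    by (simp add: algebra_simps)
  show "set_integrable lborel (lower_ray l x) (\<lambda>t. PL p l j t * g t)"
    unfolding eq by (rule set_integral_diff(1)[OF int2 int1])
  have "(LINT t:lower_ray l x|lborel. PL p l j t * (g x - g t)) =
      (LINT s:lower_ray l x|lborel. PL p l (Suc j) s * G s)"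
    using F(2) unfolding W_eq set_lebesgue_integral_def
    by (simp add: mult_ac del: P_lower.simps P_upper.simps)
  then show "(LINT t:lower_ray l x|lborel. PL p l j t * g t) =
      g x * PL p l (Suc j) x - (LINT s:lower_ray l x|lborel. PL p l (Suc j) s * G s)"
    unfolding eq set_integral_diff(2)[OF int2 int1] set_integral_mult_right
      P_lower_integral(2)[OF assms(1) fin order_refl] by simp
qed

text \<open>The region is now x <= s <= t < u, and \<open>G\<close> integrates over [x,t] to g t - g
  x; hence the plus sign.\<close>

lemma by_parts_upper:
  assumes [measurable]: "p \<in> borel_measurable borel" "G \<in> borel_measurable borel"
    and G: "\<And>a b. a \<le> b \<Longrightarrow> (LINT t:{a..b}|lborel. G t) = g b - g a"
    and fin: "P_upper p u (Suc j) x < \<infinity>"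
    and int: "set_integrable lborel (upper_ray u x) (\<lambda>s. PU p u (Suc j) s * G s)"
  shows "set_integrable lborel (upper_ray u x) (\<lambda>t. PU p u j t * g t)"
    and "(LINT t:upper_ray u x|lborel. PU p u j t * g t) =
      g x * PU p u (Suc j) x + (LINT s:upper_ray u x|lborel. PU p u (Suc j) s * G s)"
proof -
  define R where "R = {z\<in>space (borel \<Otimes>\<^sub>M borel). ereal (fst z) < u \<and> snd z \<le> fst z \<and> x \<le> snd z}"
  define W where "W s = indicator {x..} s * PU p u (Suc j) s" for s
  have R[measurable]: "R \<in> sets (borel \<Otimes>\<^sub>M borel)" unfolding R_def by measurable
  have R_eq: "(indicator R (t, s) :: real) = indicator {x..} s * indicator (upper_ray u s) t" for t s
    by (auto simp: R_def indicator_def space_pair_measure)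
  have W: "integrable lborel (\<lambda>t. indicator R (t, s) * PU p u j t)"
    "(\<integral>t. indicator R (t, s) * PU p u j t \<partial>lborel) = W s" for s
  proof -
    have "integrable lborel (\<lambda>t. indicator R (t, s) * PU p u j t) \<and>
        (\<integral>t. indicator R (t, s) * PU p u j t \<partial>lborel) = W s"
    proof (cases "x \<le> s")
      case True
      with P_upper_integral[OF assms(1) fin True] show ?thesis
        by (simp add: R_eq W_def set_integrable_def set_lebesgue_integral_def)
    qed (simp add: R_eq W_def)
    then show "integrable lborel (\<lambda>t. indicator R (t, s) * PU p u j t)"
      "(\<integral>t. indicator R (t, s) * PU p u j t \<partial>lborel) = W s" by auto
  qed
  have W_eq: "W s * G s = indicator (upper_ray u x) s *\<^sub>R (PU p u (Suc j) s * G s)" for s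
  proof (cases "ereal s < u")
    case False
    then have "upper_ray u s = {}" by (auto simp: not_less intro: order_trans[of u "ereal s"])
    then have "PU p u (Suc j) s = 0" by (simp only: P_upper.simps) simp
    then show ?thesis by (simp only: W_def) simp
  qed (auto simp: W_def indicator_def)
  have inner: "(\<integral>s. indicator R (t, s) * G s \<partial>lborel) = indicator (upper_ray u x) t * (g t - g x)" for t
  proof (cases "t \<in> upper_ray u x")
    case True
    then have "(\<integral>s. indicator R (t, s) * G s \<partial>lborel) = (LINT s:{x..t}|lborel. G s)"
      unfolding set_lebesgue_integral_def
      by (intro Bochner_Integration.integral_cong) (auto simp: R_def indicator_def space_pair_measure)
    with G[of x t] True show ?thesis by simp
  next
    case False
    then have "(t, s) \<notin> R" for s
      by (auto simp: R_def)
    with False show ?thesis by simp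
  qed
  have "integrable lborel (\<lambda>s. W s * G s)"
    using int unfolding W_eq set_integrable_def .
  note F = Fubini_weighted_kernel[OF _ _ R _ W this, unfolded inner]
  have int1: "set_integrable lborel (upper_ray u x) (\<lambda>t. PU p u j t * (g t - g x))"
    using F(1) by (simp add: set_integrable_def mult_ac)
  have int2: "set_integrable lborel (upper_ray u x) (\<lambda>t. g x * PU p u j t)"
    using P_upper_integral(1)[OF assms(1) fin order_refl] by (rule set_integrable_mult_right)
  have eq: "PU p u j t * g t = g x * PU p u j t + PU p u j t * (g t - g x)" for t
    by (simp add: algebra_simps)
  show "set_integrable lborel (upper_ray u x) (\<lambda>t. PU p u j t * g t)"
    unfolding eq by (rule set_integral_add(1)[OF int2 int1])
  have "(LINT t:upper_ray u x|lborel. PU p u j t * (g t - g x)) =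
      (LINT s:upper_ray u x|lborel. PU p u (Suc j) s * G s)"
    using F(2) unfolding W_eq set_lebesgue_integral_def
    by (simp add: mult_ac del: P_lower.simps P_upper.simps)
  then show "(LINT t:upper_ray u x|lborel. PU p u j t * g t) =
      g x * PU p u (Suc j) x + (LINT s:upper_ray u x|lborel. PU p u (Suc j) s * G s)"
    unfolding eq set_integral_add(2)[OF int2 int1] set_integral_mult_right
      P_upper_integral(2)[OF assms(1) fin order_refl] by simp
qed

declare P_lower.simps(2) [simp del] P_upper.simps(2) [simp del]

section \<open>Ray integrals as functions of their finite endpoint\<close>

text \<open>A fixed anchor a reduces the dependence on y to an integral over a compact interval,
  where continuity and differentiability in the endpoint are standard. The two closed pieces share
  only the null set {a}.\<close>

lemma lower_ray_integral:
  fixes f :: "real \<Rightarrow> real"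
  assumes int: "set_integrable lborel (lower_ray l b) f" and "l < ereal a" "a \<le> y" "y \<le> b"
  shows "(LINT t:lower_ray l y|lborel. f t) = (LINT t:lower_ray l a|lborel. f t) + integral {a..y} f"
proof -
  have sub: "{a..y} \<subseteq> lower_ray l b" "lower_ray l a \<subseteq> lower_ray l b"
    using assms by (auto intro: less_le_trans[of l "ereal a"])
  have i1: "set_integrable lborel {a..y} f" and i2: "set_integrable lborel (lower_ray l a) f"
    using sub by (auto intro: set_integrable_subset[OF int])
  have eq: "lower_ray l y = lower_ray l a \<union> {a..y}"
    using assms by (auto intro: less_le_trans[of l "ereal a"])
  have "AE t in lborel. \<not> (t \<in> lower_ray l a \<and> t \<in> {a..y})"
    using AE_lborel_singleton[of a] by eventually_elim auto
  from set_integral_Un_AE[OF this _ _ i2 i1] show ?thesis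
    unfolding eq set_borel_integral_eq_integral(2)[OF i1] by simp
qed

lemma upper_ray_integral:
  fixes f :: "real \<Rightarrow> real"
  assumes int: "set_integrable lborel (upper_ray u a) f" and "ereal b < u" "a \<le> y" "y \<le> b"
  shows "(LINT t:upper_ray u y|lborel. f t) = (LINT t:upper_ray u a|lborel. f t) - integral {a..y} f"
proof -
  have sub: "{a..y} \<subseteq> upper_ray u a" "upper_ray u y \<subseteq> upper_ray u a"
    using assms by (auto intro: le_less_trans[of _ "ereal b"])
  have i1: "set_integrable lborel {a..y} f" and i2: "set_integrable lborel (upper_ray u y) f"
    using sub by (auto intro: set_integrable_subset[OF int])
  have eq: "upper_ray u a = upper_ray u y \<union> {a..y}"
    using assms by (auto intro: le_less_trans[of _ "ereal b"])
  have "AE t in lborel. \<not> (t \<in> upper_ray u y \<and> t \<in> {a..y})"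
    using AE_lborel_singleton[of y] by eventually_elim auto
  from set_integral_Un_AE[OF this _ _ i2 i1] show ?thesis
    unfolding eq set_borel_integral_eq_integral(2)[OF i1] by simp
qed

lemma indefinite_integral_deriv:
  fixes f :: "real \<Rightarrow> real"
  assumes "f integrable_on {a..b}" "a < x" "x < b" "isCont f x"
  shows "((\<lambda>y. integral {a..y} f) has_field_derivative f x) (at x)"
proof -
  have "((\<lambda>y. integral {a..y} f) has_vector_derivative f x) (at x within {a..b} - {})"
    using assms by (intro integral_has_vector_derivative_continuous_at)
      (auto intro: continuous_within_subset)
  then have "((\<lambda>y. integral {a..y} f) has_field_derivative f x) (at x within {a..b})"
    by (simp add: has_real_derivative_iff_has_vector_derivative)
  then show ?thesis
    using assms by (simp add: at_within_Icc_at)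
qed

lemma lower_ray_deriv:
  fixes f :: "real \<Rightarrow> real"
  assumes int: "set_integrable lborel (lower_ray l b) f" and l: "l < ereal a" and x: "a < x" "x < b"
    and cont: "isCont f x"
  shows "((\<lambda>y. LINT t:lower_ray l y|lborel. f t) has_field_derivative f x) (at x)"
proof (rule has_field_derivative_transform_within_open)
  have "set_integrable lborel {a..b} f"
    using l by (intro set_integrable_subset[OF int]) (auto intro: less_le_trans[of l "ereal a"])
  then have "f integrable_on {a..b}" by (rule set_borel_integral_eq_integral(1))
  from indefinite_integral_deriv[OF this x cont]
  show "((\<lambda>y. (LINT t:lower_ray l a|lborel. f t) + integral {a..y} f) has_field_derivative f x) (at x)"
    by (auto intro!: derivative_eq_intros)
  show "(LINT t:lower_ray l a|lborel. f t) + integral {a..y} f = (LINT t:lower_ray l y|lborel. f t)"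
    if "y \<in> {a<..<b}" for y
    using lower_ray_integral[OF int l, of y] that by simp
qed (use x in auto)

lemma upper_ray_deriv:
  fixes f :: "real \<Rightarrow> real"
  assumes int: "set_integrable lborel (upper_ray u a) f" and u: "ereal b < u" and x: "a < x" "x < b"
    and cont: "isCont f x"
  shows "((\<lambda>y. LINT t:upper_ray u y|lborel. f t) has_field_derivative - f x) (at x)"
proof (rule has_field_derivative_transform_within_open)
  have "set_integrable lborel {a..b} f"
    using u by (intro set_integrable_subset[OF int]) (auto intro: le_less_trans[of _ "ereal b"])
  then have "f integrable_on {a..b}" by (rule set_borel_integral_eq_integral(1))
  from indefinite_integral_deriv[OF this x cont]
  show "((\<lambda>y. (LINT t:upper_ray u a|lborel. f t) - integral {a..y} f) has_field_derivative - f x) (at x)"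
    by (auto intro!: derivative_eq_intros)
  show "(LINT t:upper_ray u a|lborel. f t) - integral {a..y} f = (LINT t:upper_ray u y|lborel. f t)"
    if "y \<in> {a<..<b}" for y
    using upper_ray_integral[OF int u, of y] that by simp
qed (use x in auto)

lemma lower_ray_isCont:
  fixes f :: "real \<Rightarrow> real"
  assumes int: "set_integrable lborel (lower_ray l b) f" and l: "l < ereal a" and x: "a < x" "x < b"
  shows "isCont (\<lambda>y. LINT t:lower_ray l y|lborel. f t) x"
proof -
  have "set_integrable lborel {a..b} f"
    using l by (intro set_integrable_subset[OF int]) (auto intro: less_le_trans[of l "ereal a"])
  then have "continuous_on {a..b} (\<lambda>y. integral {a..y} f)"
    by (intro indefinite_integral_continuous_1 set_borel_integral_eq_integral(1))
  then have "continuous_on {a..b} (\<lambda>y. (LINT t:lower_ray l a|lborel. f t) + integral {a..y} f)"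
    by (intro continuous_intros)
  then have "continuous_on {a..b} (\<lambda>y. LINT t:lower_ray l y|lborel. f t)"
    by (rule continuous_on_eq) (rule lower_ray_integral[OF int l, symmetric]; simp)
  then show ?thesis
    using x by (intro continuous_on_interior[of "{a..b}"]) auto
qed

lemma upper_ray_isCont:
  fixes f :: "real \<Rightarrow> real"
  assumes int: "set_integrable lborel (upper_ray u a) f" and u: "ereal b < u" and x: "a < x" "x < b"
  shows "isCont (\<lambda>y. LINT t:upper_ray u y|lborel. f t) x"
proof -
  have "set_integrable lborel {a..b} f"
    using u by (intro set_integrable_subset[OF int]) (auto intro: le_less_trans[of _ "ereal b"])
  then have "continuous_on {a..b} (\<lambda>y. integral {a..y} f)"
    by (intro indefinite_integral_continuous_1 set_borel_integral_eq_integral(1))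
  then have "continuous_on {a..b} (\<lambda>y. (LINT t:upper_ray u a|lborel. f t) - integral {a..y} f)"
    by (intro continuous_intros)
  then have "continuous_on {a..b} (\<lambda>y. LINT t:upper_ray u y|lborel. f t)"
    by (rule continuous_on_eq) (rule upper_ray_integral[OF int u, symmetric]; simp)
  then show ?thesis
    using x by (intro continuous_on_interior[of "{a..b}"]) auto
qed

lemma set_integrable_mult_continuous:
  fixes q g :: "real \<Rightarrow> real"
  assumes q: "set_integrable lborel {a..b} q" and g: "continuous_on UNIV g"
  shows "set_integrable lborel {a..b} (\<lambda>t. q t * g t)"
proof -
  have [measurable]: "g \<in> borel_measurable borel"
    using g by (rule borel_measurable_continuous_onI)
  obtain B where B: "\<And>t. t \<in> {a..b} \<Longrightarrow> \<bar>g t\<bar> \<le> B"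
  proof -
    have "bounded (g ` {a..b})"
      using g by (intro compact_imp_bounded compact_continuous_image) (auto intro: continuous_on_subset)
    then obtain B where "\<forall>y\<in>g ` {a..b}. norm y \<le> B" by (auto simp: bounded_iff)
    then show ?thesis by (intro that[of B]) auto
  qed
  have "integrable lborel (\<lambda>t. (indicator {a..b} t *\<^sub>R q t) * g t)"
  proof (rule Bochner_Integration.integrable_bound)
    show "integrable lborel (\<lambda>t. B * (indicator {a..b} t *\<^sub>R q t))"
      using q by (auto simp: set_integrable_def)
    show "(\<lambda>t. indicator {a..b} t *\<^sub>R q t * g t) \<in> borel_measurable lborel"
      using borel_measurable_integrable[OF q[unfolded set_integrable_def]] by measurable
    show "AE t in lborel. norm (indicator {a..b} t *\<^sub>R q t * g t) \<le> norm (B * (indicator {a..b} t *\<^sub>R q t))"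
    proof (intro always_eventually allI)
      fix t show "norm (indicator {a..b} t *\<^sub>R q t * g t) \<le> norm (B * (indicator {a..b} t *\<^sub>R q t))"
        using B[of t] abs_ge_self[of B]
        by (auto simp: indicator_def abs_mult mult.commute[of "\<bar>q t\<bar>"] intro!: mult_right_mono)
    qed
  qed
  then show ?thesis by (simp add: set_integrable_def mult.assoc)
qed

section \<open>Kernel expectations as Lebesgue integrals\<close>

text \<open>The division points of the density setting form a finite set; \<open>I_AE\<close>
  records that they are negligible inside (l,u).\<close>

locale kernel_setting =
  fixes \<Omega> :: "'a measure" and Z :: "'a \<Rightarrow> real" and p w :: "real \<Rightarrow> real"
    and l u :: ereal and I :: "real set"
  assumes prob: "prob_space \<Omega>"
    and dens: "distributed \<Omega> lborel Z (\<lambda>x. ennreal (p x))"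
    and p_nonneg: "\<And>x. 0 \<le> p x"
    and open_I: "open I"
    and I_range: "\<And>x. x \<in> I \<Longrightarrow> l < ereal x \<and> ereal x < u"
    and I_iff: "\<And>x. x \<in> I \<longleftrightarrow> 0 < p x"
    and I_AE: "AE x in lborel. l < ereal x \<and> ereal x < u \<longrightarrow> x \<in> I"
    and p_cont: "continuous_on I p"
    and w_nz: "\<And>x. x \<in> I \<Longrightarrow> w x \<noteq> 0"
begin

abbreviation mL :: "nat \<Rightarrow> real \<Rightarrow> real" where "mL i \<equiv> (deriv ^^ i) (m_lower p w l)"
abbreviation mU :: "nat \<Rightarrow> real \<Rightarrow> real" where "mU i \<equiv> (deriv ^^ i) (m_upper p w u)"

abbreviation K :: "nat \<Rightarrow> nat \<Rightarrow> real \<Rightarrow> real \<Rightarrow> real" where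
  "K i j x v \<equiv> K_kernel p w l u i j x v"

text \<open>A Borel function almost everywhere equal to p(v) times the kernel. Both rays are closed
  at x, so the value at v = x may differ from that of the kernel.\<close>

definition weight :: "nat \<Rightarrow> nat \<Rightarrow> real \<Rightarrow> real \<Rightarrow> real" where
  "weight i j x v = (-1) ^ j * mU i x * (indicator (lower_ray l x) v * PL p l j v)
     - mL i x * (indicator (upper_ray u x) v * PU p u j v)"

lemma p_measurable [measurable]: "p \<in> borel_measurable borel"
  using distributed_real_measurable[of lborel p, OF _ dens] p_nonneg by simp

lemma weight_measurable [measurable]: "weight i j x \<in> borel_measurable borel"
  unfolding weight_def by measurable

lemma weight_AE:
  assumes "x \<in> I"
  shows "AE v in lborel. p v * K i j x v = weight i j x v"
  using I_AE AE_lborel_singleton[of x]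
proof eventually_elim
  case (elim v)
  show ?case
  proof (cases "v \<in> I")
    case True
    with I_range[of v] I_iff[of v] I_range[OF assms] elim show ?thesis
      by (auto simp: K_kernel_def weight_def indicator_def algebra_simps)
  next
    case False
    then have "p v = 0" using I_iff[of v] p_nonneg[of v] by auto
    \<comment> \<open>Almost every v outside \<open>I\<close> lies outside (l,u). On the left of x
      it is then not above l, and on the right not below u, so it belongs to neither ray.\<close>
    moreover have "v \<le> x \<Longrightarrow> ereal v < u" "x \<le> v \<Longrightarrow> l < ereal v"
      using I_range[OF assms] le_less_trans[of "ereal v" "ereal x" u] less_le_trans[of l "ereal x" "ereal v"]
      by simp_all
    then have "v \<notin> lower_ray l x" "v \<notin> upper_ray u x"
      using elim False by auto
    ultimately show ?thesis by (simp add: weight_def)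
  qed
qed

lemma expect_K:
  assumes "x \<in> I" and [measurable]: "\<psi> \<in> borel_measurable borel" and "AE v in lborel. \<phi> v = \<psi> v"
  shows "expect_finite \<Omega> Z (\<lambda>v. K i j x v * \<phi> v) \<longleftrightarrow> integrable lborel (\<lambda>v. weight i j x v * \<psi> v)"
    and "expect \<Omega> Z (\<lambda>v. K i j x v * \<phi> v) = (\<integral>v. weight i j x v * \<psi> v \<partial>lborel)"
proof -
  have *: "AE v in lborel. p v * (K i j x v * \<phi> v) = weight i j x v * \<psi> v"
    using weight_AE[OF assms(1), of i j] assms(3)
    by eventually_elim (simp add: mult.assoc[symmetric])
  show "expect_finite \<Omega> Z (\<lambda>v. K i j x v * \<phi> v) \<longleftrightarrow> integrable lborel (\<lambda>v. weight i j x v * \<psi> v)"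
    and "expect \<Omega> Z (\<lambda>v. K i j x v * \<phi> v) = (\<integral>v. weight i j x v * \<psi> v \<partial>lborel)"
    by (rule expect_lborel[OF dens p_nonneg _ *]; measurable)+
qed

text \<open>Restricting to one ray isolates one half of the weight up to the common point x;
  dividing by its coefficient is possible only when that is nonzero.\<close>

lemma expect_K_finiteD:
  assumes "x \<in> I" and [measurable]: "\<psi> \<in> borel_measurable borel" and "AE v in lborel. \<phi> v = \<psi> v"
    and fin: "expect_finite \<Omega> Z (\<lambda>v. K i j x v * \<phi> v)"
  shows "mU i x \<noteq> 0 \<Longrightarrow> set_integrable lborel (lower_ray l x) (\<lambda>v. PL p l j v * \<psi> v)"
    and "mL i x \<noteq> 0 \<Longrightarrow> set_integrable lborel (upper_ray u x) (\<lambda>v. PU p u j v * \<psi> v)"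
proof -
  have int: "integrable lborel (\<lambda>v. weight i j x v * \<psi> v)"
    using fin expect_K(1)[OF assms(1-3)] by simp
  { assume nz: "mU i x \<noteq> 0"
    have A: "integrable lborel (\<lambda>v. indicator (lower_ray l x) v *\<^sub>R (weight i j x v * \<psi> v))"
      by (rule integrable_mult_indicator[OF _ int]) measurable
    have B: "AE v in lborel. indicator (lower_ray l x) v *\<^sub>R (weight i j x v * \<psi> v) =
        ((-1) ^ j * mU i x) * (indicator (lower_ray l x) v *\<^sub>R (PL p l j v * \<psi> v))"
      using AE_lborel_singleton[of x] by eventually_elim (auto simp: weight_def indicator_def)
    have "integrable lborel (\<lambda>v. ((-1) ^ j * mU i x) * (indicator (lower_ray l x) v *\<^sub>R (PL p l j v * \<psi> v)))"
      by (rule integrable_cong_AE_imp[OF A _ B]) measurable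
    with nz show "set_integrable lborel (lower_ray l x) (\<lambda>v. PL p l j v * \<psi> v)"
      unfolding set_integrable_def by (subst (asm) integrable_mult_left_iff) auto }
  { assume nz: "mL i x \<noteq> 0"
    have A: "integrable lborel (\<lambda>v. indicator (upper_ray u x) v *\<^sub>R (weight i j x v * \<psi> v))"
      by (rule integrable_mult_indicator[OF _ int]) measurable
    have B: "AE v in lborel. indicator (upper_ray u x) v *\<^sub>R (weight i j x v * \<psi> v) =
        (- mL i x) * (indicator (upper_ray u x) v *\<^sub>R (PU p u j v * \<psi> v))"
      using AE_lborel_singleton[of x] by eventually_elim (auto simp: weight_def indicator_def)
    have "integrable lborel (\<lambda>v. (- mL i x) * (indicator (upper_ray u x) v *\<^sub>R (PU p u j v * \<psi> v)))"
      by (rule integrable_cong_AE_imp[OF A _ B]) measurable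
    with nz show "set_integrable lborel (upper_ray u x) (\<lambda>v. PU p u j v * \<psi> v)"
      unfolding set_integrable_def by (subst (asm) integrable_mult_left_iff) auto }
qed

text \<open>Where a coefficient vanishes, its product with the integral is 0 whatever default value
  the integral takes, so integrability is asked only for nonzero coefficients.\<close>

lemma expect_K_split:
  assumes "x \<in> I" and [measurable]: "\<psi> \<in> borel_measurable borel" and "AE v in lborel. \<phi> v = \<psi> v"
    and L: "mU i x \<noteq> 0 \<Longrightarrow> set_integrable lborel (lower_ray l x) (\<lambda>v. PL p l j v * \<psi> v)"
    and U: "mL i x \<noteq> 0 \<Longrightarrow> set_integrable lborel (upper_ray u x) (\<lambda>v. PU p u j v * \<psi> v)"
  shows "expect \<Omega> Z (\<lambda>v. K i j x v * \<phi> v) =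
      (-1) ^ j * (mU i x * (LINT v:lower_ray l x|lborel. PL p l j v * \<psi> v))
      - mL i x * (LINT v:upper_ray u x|lborel. PU p u j v * \<psi> v)"
    and "expect_finite \<Omega> Z (\<lambda>v. K i j x v * \<phi> v)"
proof -
  have eq: "weight i j x v * \<psi> v =
      ((-1) ^ j * mU i x) * (indicator (lower_ray l x) v *\<^sub>R (PL p l j v * \<psi> v))
      - mL i x * (indicator (upper_ray u x) v *\<^sub>R (PU p u j v * \<psi> v))" for v
    by (simp add: weight_def algebra_simps)
  have i1: "integrable lborel (\<lambda>v. ((-1) ^ j * mU i x) * (indicator (lower_ray l x) v *\<^sub>R (PL p l j v * \<psi> v)))"
    using L unfolding set_integrable_def by (intro integrable_mult_right) auto
  have i2: "integrable lborel (\<lambda>v. mL i x * (indicator (upper_ray u x) v *\<^sub>R (PU p u j v * \<psi> v)))"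
    using U unfolding set_integrable_def by (intro integrable_mult_right) auto
  show "expect \<Omega> Z (\<lambda>v. K i j x v * \<phi> v) =
      (-1) ^ j * (mU i x * (LINT v:lower_ray l x|lborel. PL p l j v * \<psi> v))
      - mL i x * (LINT v:upper_ray u x|lborel. PU p u j v * \<psi> v)"
    unfolding expect_K(2)[OF assms(1-3)] eq Bochner_Integration.integral_diff[OF i1 i2]
      integral_mult_right_zero set_lebesgue_integral_def by simp
  show "expect_finite \<Omega> Z (\<lambda>v. K i j x v * \<phi> v)"
    unfolding expect_K(1)[OF assms(1-3)] eq by (rule Bochner_Integration.integrable_diff[OF i1 i2])
qed

text \<open>This is \<open>M_kernel\<close> for second index at least 0. Index -1 enters only with
  first index 0, through \<open>M_base\<close>.\<close>

definition M :: "nat \<Rightarrow> nat \<Rightarrow> real \<Rightarrow> real" where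
  "M i j x = (-1) ^ j * (mU i x * PL p l (Suc j) x) - mL i x * PU p u (Suc j) x"

lemma M_kernel_eq: "M_kernel p w l u i (int j) x = M i j x"
  by (simp add: M_kernel_def M_def nat_add_distrib)

text \<open>The hypothesis bounds the sum of three absolute values. Domination gives each term
  separately once measurability is secured by passing to weights and to a Borel version of
  \<open>deriv g\<close>.\<close>

lemma kernel_hyp_expect_finite:
  assumes H: "kernel_hyp \<Omega> Z p w l u I i j g" and x: "x \<in> I"
  shows "expect_finite \<Omega> Z (\<lambda>v. K i j x v * g v)"
    and "expect_finite \<Omega> Z (\<lambda>v. K i (Suc j) x v * deriv g v)"
    and "expect_finite \<Omega> Z (\<lambda>v. K (Suc i) j x v * g v)"
proof -
  have ac: "loc_abs_cont_on UNIV g" using H by (simp add: kernel_hyp_def)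
  have [measurable]: "g \<in> borel_measurable borel"
    using loc_abs_cont_on_imp_continuous_on[OF ac] by (auto intro: borel_measurable_continuous_onI)
  obtain G where [measurable]: "G \<in> borel_measurable borel" and G: "AE v in lborel. deriv g v = G v"
    using abs_cont_FTC[OF ac] by metis
  define \<psi> where "\<psi> v = \<bar>weight i j x v * g v\<bar> + \<bar>weight i (Suc j) x v * G v\<bar>
      + \<bar>weight (Suc i) j x v * g v\<bar>" for v
  have [measurable]: "\<psi> \<in> borel_measurable borel" unfolding \<psi>_def by measurable
  have ae: "AE v in lborel. p v * (\<bar>K i j x v * g v\<bar> + \<bar>K i (Suc j) x v * deriv g v\<bar>
      + \<bar>K (Suc i) j x v * g v\<bar>) = \<psi> v"
    using weight_AE[OF x, of i j] weight_AE[OF x, of i "Suc j"] weight_AE[OF x, of "Suc i" j] G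
  proof eventually_elim
    case (elim v)
    show ?case
      unfolding \<psi>_def elim(1-3)[symmetric] elim(4)
      using p_nonneg[of v] by (simp add: abs_mult algebra_simps)
  qed
  have int: "integrable lborel \<psi>"
    using H x expect_lborel(1)[OF dens p_nonneg _ ae] by (simp add: kernel_hyp_def)
  have *: "integrable lborel (\<lambda>v. weight i' j' x v * \<phi> v)"
    if [measurable]: "\<phi> \<in> borel_measurable borel" and "\<And>v. \<bar>weight i' j' x v * \<phi> v\<bar> \<le> \<psi> v" for i' j' \<phi>
  proof (rule Bochner_Integration.integrable_bound[OF int])
    show "AE v in lborel. norm (weight i' j' x v * \<phi> v) \<le> norm (\<psi> v)"
      using that(2) by (auto intro!: always_eventually intro: order_trans[OF _ abs_ge_self])
  qed measurable
  show "expect_finite \<Omega> Z (\<lambda>v. K i j x v * g v)"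
    by (subst expect_K(1)[OF x, of g]) (auto intro!: * simp: \<psi>_def)
  show "expect_finite \<Omega> Z (\<lambda>v. K i (Suc j) x v * deriv g v)"
    by (subst expect_K(1)[OF x _ G]) (auto intro!: * simp: \<psi>_def)
  show "expect_finite \<Omega> Z (\<lambda>v. K (Suc i) j x v * g v)"
    by (subst expect_K(1)[OF x, of g]) (auto intro!: * simp: \<psi>_def)
qed

text \<open>The lower half changes sign under integration by parts and the upper half does not; the
  factor (-1)^j on the lower half alone absorbs this, so the remainder is again a kernel
  expectation, with index j+1.\<close>

lemma kernel_by_parts:
  assumes H: "kernel_hyp \<Omega> Z p w l u I i j g" and x: "x \<in> I"
  shows "expect \<Omega> Z (\<lambda>v. K i j x v * g v) =
    g x * M i j x + expect \<Omega> Z (\<lambda>v. K i (Suc j) x v * deriv g v)"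
proof -
  have ac: "loc_abs_cont_on UNIV g" and fin: "P_lower p l (Suc j) x < \<infinity>" "P_upper p u (Suc j) x < \<infinity>"
    using H x by (auto simp: kernel_hyp_def)
  have g[measurable]: "g \<in> borel_measurable borel"
    using loc_abs_cont_on_imp_continuous_on[OF ac] by (auto intro: borel_measurable_continuous_onI)
  obtain G where G[measurable]: "G \<in> borel_measurable borel" and ae: "AE v in lborel. deriv g v = G v"
    and FTC: "\<And>x y. x \<le> y \<Longrightarrow> (LINT t:{x..y}|lborel. G t) = g y - g x"
    using abs_cont_FTC[OF ac] by metis
  note fL = expect_K_finiteD(1)[OF x G ae kernel_hyp_expect_finite(2)[OF H x]]
  note fU = expect_K_finiteD(2)[OF x G ae kernel_hyp_expect_finite(2)[OF H x]]
  note L = by_parts_lower[OF p_measurable G FTC fin(1) fL]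
  note U = by_parts_upper[OF p_measurable G FTC fin(2) fU]
  have e1: "expect \<Omega> Z (\<lambda>v. K i j x v * g v) =
      (-1) ^ j * (mU i x * (LINT v:lower_ray l x|lborel. PL p l j v * g v))
      - mL i x * (LINT v:upper_ray u x|lborel. PU p u j v * g v)"
    by (rule expect_K_split(1)[OF x g]) (auto intro: L(1) U(1))
  have e2: "expect \<Omega> Z (\<lambda>v. K i (Suc j) x v * deriv g v) =
      (-1) ^ Suc j * (mU i x * (LINT v:lower_ray l x|lborel. PL p l (Suc j) v * G v))
      - mL i x * (LINT v:upper_ray u x|lborel. PU p u (Suc j) v * G v)"
    by (rule expect_K_split(1)[OF x G ae]) (auto intro: fL fU)
  \<comment> \<open>The by-parts formula is available only for a nonzero coefficient; otherwise both
    sides are 0.\<close>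
  have l: "mU i x * (LINT v:lower_ray l x|lborel. PL p l j v * g v) =
      mU i x * (g x * PL p l (Suc j) x - (LINT v:lower_ray l x|lborel. PL p l (Suc j) v * G v))"
    by (cases "mU i x = 0") (auto simp: L(2))
  have u: "mL i x * (LINT v:upper_ray u x|lborel. PU p u j v * g v) =
      mL i x * (g x * PU p u (Suc j) x + (LINT v:upper_ray u x|lborel. PU p u (Suc j) v * G v))"
    by (cases "mL i x = 0") (auto simp: U(2))
  show ?thesis
    unfolding e1 e2 l u M_def by (simp add: algebra_simps)
qed

lemma expect_K_diff_const:
  assumes x: "x \<in> I" and fin: "P_lower p l (Suc j) x < \<infinity>" "P_upper p u (Suc j) x < \<infinity>"
    and g[measurable]: "g \<in> borel_measurable borel" and f: "expect_finite \<Omega> Z (\<lambda>v. K i j x v * g v)"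
  shows "expect \<Omega> Z (\<lambda>v. K i j x v * (g v - c)) = expect \<Omega> Z (\<lambda>v. K i j x v * g v) - c * M i j x"
proof -
  have one: "expect \<Omega> Z (\<lambda>v. K i j x v * 1) = M i j x" "expect_finite \<Omega> Z (\<lambda>v. K i j x v * 1)"
    using expect_K_split[OF x, of "\<lambda>_. 1" "\<lambda>_. 1" i j]
      P_lower_integral[OF p_measurable fin(1) order_refl] P_upper_integral[OF p_measurable fin(2) order_refl]
    by (simp_all add: M_def)
  have i1: "integrable lborel (\<lambda>v. weight i j x v * g v)"
    using f by (subst (asm) expect_K(1)[OF x g]) auto
  have i2: "integrable lborel (\<lambda>v. weight i j x v * 1)"
    using one(2) by (subst (asm) expect_K(1)[OF x, of "\<lambda>_. 1"]) auto
  have "expect \<Omega> Z (\<lambda>v. K i j x v * (g v - c)) = (\<integral>v. weight i j x v * (g v - c) \<partial>lborel)"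
    by (rule expect_K(2)[OF x]) auto
  also have "\<dots> = (\<integral>v. weight i j x v * g v - c * (weight i j x v * 1) \<partial>lborel)"
    by (simp add: algebra_simps)
  also have "\<dots> = (\<integral>v. weight i j x v * g v \<partial>lborel) - c * (\<integral>v. weight i j x v * 1 \<partial>lborel)"
    using i1 i2 by (subst Bochner_Integration.integral_diff) auto
  also have "(\<integral>v. weight i j x v * g v \<partial>lborel) = expect \<Omega> Z (\<lambda>v. K i j x v * g v)"
    by (rule expect_K(2)[OF x g, symmetric]) auto
  also have "(\<integral>v. weight i j x v * 1 \<partial>lborel) = M i j x"
    unfolding one(1)[symmetric] by (rule expect_K(2)[OF x, symmetric]) auto
  finally show ?thesis .
qed

section \<open>Differentiating kernel expectations in x\<close>

lemma interval_in_I: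
  assumes "x \<in> I"
  obtains a b where "a < x" "x < b" "a \<in> I" "b \<in> I"
proof -
  obtain r where r: "r > 0" "cball x r \<subseteq> I"
    using open_I assms open_contains_cball by blast
  show ?thesis
    by (rule that[of "x - r" "x + r"]) (use r in \<open>auto simp: cball_eq_atLeastAtMost subset_iff\<close>)
qed

text \<open>Only the behaviour near l is at stake: between two points of \<open>I\<close> the
  continuous g is bounded and \<open>PL p l j\<close> is integrable.\<close>

lemma lower_integrable_all:
  assumes fin: "\<And>y. y \<in> I \<Longrightarrow> P_lower p l (Suc j) y < \<infinity>" and g: "continuous_on UNIV g"
    and x: "x \<in> I" and int: "set_integrable lborel (lower_ray l x) (\<lambda>v. PL p l j v * g v)" and y: "y \<in> I"
  shows "set_integrable lborel (lower_ray l y) (\<lambda>v. PL p l j v * g v)"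
proof (cases "y \<le> x")
  case True
  then show ?thesis by (intro set_integrable_subset[OF int]) auto
next
  case False
  have lx: "l < ereal x" using I_range[OF x] by simp
  have "set_integrable lborel {x..y} (PL p l j)"
    using lx by (intro set_integrable_subset[OF P_lower_integral(1)[OF p_measurable fin[OF y] order_refl]])
      (auto intro: less_le_trans[of l "ereal x"])
  from set_integrable_Un[OF int set_integrable_mult_continuous[OF this g]]
  have "set_integrable lborel (lower_ray l x \<union> {x..y}) (\<lambda>v. PL p l j v * g v)" by simp
  then show ?thesis
    by (rule set_integrable_subset) auto
qed

lemma upper_integrable_all:
  assumes fin: "\<And>y. y \<in> I \<Longrightarrow> P_upper p u (Suc j) y < \<infinity>" and g: "continuous_on UNIV g"
    and x: "x \<in> I" and int: "set_integrable lborel (upper_ray u x) (\<lambda>v. PU p u j v * g v)" and y: "y \<in> I"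
  shows "set_integrable lborel (upper_ray u y) (\<lambda>v. PU p u j v * g v)"
proof (cases "x \<le> y")
  case True
  then show ?thesis by (intro set_integrable_subset[OF int]) auto
next
  case False
  have ux: "ereal x < u" using I_range[OF x] by simp
  have "set_integrable lborel {y..x} (PU p u j)"
    using ux by (intro set_integrable_subset[OF P_upper_integral(1)[OF p_measurable fin[OF y] order_refl]])
      (auto intro: le_less_trans[of _ "ereal x"])
  from set_integrable_Un[OF int set_integrable_mult_continuous[OF this g]]
  have "set_integrable lborel (upper_ray u x \<union> {y..x}) (\<lambda>v. PU p u j v * g v)" by simp
  then show ?thesis
    by (rule set_integrable_subset) auto
qed

lemma p_isCont: "x \<in> I \<Longrightarrow> isCont p x"
  using p_cont open_I by (simp add: continuous_on_eq_continuous_at)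

text \<open>For j = 0 this is continuity of the density on \<open>I\<close>; for larger j the
  function is an indefinite integral. The finiteness premise is guarded by j = \<open>Suc k\<close>,
  the only case where it has content to supply.\<close>

lemma PL_isCont:
  assumes "x \<in> I" and fin: "\<And>k y. j = Suc k \<Longrightarrow> y \<in> I \<Longrightarrow> P_lower p l j y < \<infinity>"
  shows "isCont (PL p l j) x"
proof (cases j)
  case 0
  then show ?thesis using p_isCont[OF assms(1)] p_nonneg by simp
next
  case (Suc k)
  obtain a b where ab: "a < x" "x < b" "a \<in> I" "b \<in> I" using interval_in_I[OF assms(1)] .
  have fb: "P_lower p l (Suc k) b < \<infinity>" using fin[OF Suc ab(4)] Suc by simp
  note P = P_lower_integral[OF p_measurable fb]
  have "isCont (\<lambda>y. LINT t:lower_ray l y|lborel. PL p l k t) x"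
    using P(1)[OF order_refl] I_range[OF ab(3)] ab by (intro lower_ray_isCont[where a = a and b = b]) auto
  moreover have "\<forall>\<^sub>F y in nhds x. (LINT t:lower_ray l y|lborel. PL p l k t) = PL p l j y"
    using eventually_nhds_in_open[of "{..<b}" x] ab(2)
    by (auto simp: Suc P(2) elim: eventually_mono)
  ultimately show ?thesis by (simp add: isCont_cong)
qed

lemma PU_isCont:
  assumes "x \<in> I" and fin: "\<And>k y. j = Suc k \<Longrightarrow> y \<in> I \<Longrightarrow> P_upper p u j y < \<infinity>"
  shows "isCont (PU p u j) x"
proof (cases j)
  case 0
  then show ?thesis using p_isCont[OF assms(1)] p_nonneg by simp
next
  case (Suc k)
  obtain a b where ab: "a < x" "x < b" "a \<in> I" "b \<in> I" using interval_in_I[OF assms(1)] .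
  have fa: "P_upper p u (Suc k) a < \<infinity>" using fin[OF Suc ab(3)] Suc by simp
  note P = P_upper_integral[OF p_measurable fa]
  have "isCont (\<lambda>y. LINT t:upper_ray u y|lborel. PU p u k t) x"
    using P(1)[OF order_refl] I_range[OF ab(4)] ab by (intro upper_ray_isCont[where a = a and b = b]) auto
  moreover have "\<forall>\<^sub>F y in nhds x. (LINT t:upper_ray u y|lborel. PU p u k t) = PU p u j y"
    using eventually_nhds_in_open[of "{a<..}" x] ab(1)
    by (auto simp: Suc P(2) elim: eventually_mono)
  ultimately show ?thesis by (simp add: isCont_cong)
qed

text \<open>Finiteness of the expectation controls the integral against \<open>g\<close> only where the coefficient
  \<open>m\<^sup>(\<^sup>i\<^sup>)\<close> is nonzero. One such point gives integrability at every point of \<open>I\<close>; if there is none,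
  the junk value of the integral is always multiplied by zero.\<close>

lemma lower_term_deriv:
  assumes x: "x \<in> I" and fin: "\<And>y. y \<in> I \<Longrightarrow> P_lower p l (Suc j) y < \<infinity>"
    and cont: "isCont (PL p l j) x" and g: "continuous_on UNIV g"
    and int: "\<And>y. y \<in> I \<Longrightarrow> mU i y \<noteq> 0 \<Longrightarrow> set_integrable lborel (lower_ray l y) (\<lambda>v. PL p l j v * g v)"
    and diff: "mU i field_differentiable (at x)"
  shows "((\<lambda>y. mU i y * (LINT v:lower_ray l y|lborel. PL p l j v * g v)) has_field_derivative
      mU (Suc i) x * (LINT v:lower_ray l x|lborel. PL p l j v * g v) + mU i x * (PL p l j x * g x)) (at x)"
    and "mU (Suc i) x \<noteq> 0 \<Longrightarrow> set_integrable lborel (lower_ray l x) (\<lambda>v. PL p l j v * g v)"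
proof -
  have dm: "(mU i has_field_derivative mU (Suc i) x) (at x)"
    using diff by (simp add: field_differentiable_derivI)
  have "((\<lambda>y. mU i y * (LINT v:lower_ray l y|lborel. PL p l j v * g v)) has_field_derivative
      mU (Suc i) x * (LINT v:lower_ray l x|lborel. PL p l j v * g v) + mU i x * (PL p l j x * g x)) (at x) \<and>
      (mU (Suc i) x \<noteq> 0 \<longrightarrow> set_integrable lborel (lower_ray l x) (\<lambda>v. PL p l j v * g v))"
  proof (cases "\<exists>y\<in>I. mU i y \<noteq> 0")
    case True
    then obtain y where y: "y \<in> I" "mU i y \<noteq> 0" by blast
    have all: "set_integrable lborel (lower_ray l z) (\<lambda>v. PL p l j v * g v)" if "z \<in> I" for z
      using fin g y(1) int[OF y] that by (rule lower_integrable_all)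
    obtain a b where ab: "a < x" "x < b" "a \<in> I" "b \<in> I" using interval_in_I[OF x] .
    have "isCont g x" using g by (simp add: continuous_on_eq_continuous_at)
    then have "isCont (\<lambda>v. PL p l j v * g v) x" using cont by (intro continuous_intros)
    then have "((\<lambda>y. LINT v:lower_ray l y|lborel. PL p l j v * g v) has_field_derivative PL p l j x * g x) (at x)"
      using all[OF ab(4)] I_range[OF ab(3)] ab by (intro lower_ray_deriv[where a = a and b = b]) auto
    with dm all[OF x] show ?thesis
      by (auto intro!: derivative_eq_intros simp: algebra_simps)
  next
    case False
    \<comment> \<open>The coefficient is identically 0 on the open set \<open>I\<close>, so its
      derivative at x is 0 as well.\<close>
    have "((\<lambda>_. 0) has_field_derivative mU (Suc i) x) (at x)"
      by (rule has_field_derivative_transform_within_open[OF dm open_I x]) (use False in auto)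
    then have 0: "mU (Suc i) x = 0" by (rule DERIV_unique) (rule DERIV_const)
    have "((\<lambda>y. mU i y * (LINT v:lower_ray l y|lborel. PL p l j v * g v)) has_field_derivative 0) (at x)"
      by (rule has_field_derivative_transform_within_open[OF DERIV_const[of 0] open_I x]) (use False in auto)
    with 0 False x show ?thesis by auto
  qed
  then show "((\<lambda>y. mU i y * (LINT v:lower_ray l y|lborel. PL p l j v * g v)) has_field_derivative
      mU (Suc i) x * (LINT v:lower_ray l x|lborel. PL p l j v * g v) + mU i x * (PL p l j x * g x)) (at x)"
    "mU (Suc i) x \<noteq> 0 \<Longrightarrow> set_integrable lborel (lower_ray l x) (\<lambda>v. PL p l j v * g v)" by auto
qed

text \<open>The same dichotomy as for the lower term; here the moving endpoint is the lower limit of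
  integration, which produces the minus sign.\<close>

lemma upper_term_deriv:
  assumes x: "x \<in> I" and fin: "\<And>y. y \<in> I \<Longrightarrow> P_upper p u (Suc j) y < \<infinity>"
    and cont: "isCont (PU p u j) x" and g: "continuous_on UNIV g"
    and int: "\<And>y. y \<in> I \<Longrightarrow> mL i y \<noteq> 0 \<Longrightarrow> set_integrable lborel (upper_ray u y) (\<lambda>v. PU p u j v * g v)"
    and diff: "mL i field_differentiable (at x)"
  shows "((\<lambda>y. mL i y * (LINT v:upper_ray u y|lborel. PU p u j v * g v)) has_field_derivative
      mL (Suc i) x * (LINT v:upper_ray u x|lborel. PU p u j v * g v) - mL i x * (PU p u j x * g x)) (at x)"
    and "mL (Suc i) x \<noteq> 0 \<Longrightarrow> set_integrable lborel (upper_ray u x) (\<lambda>v. PU p u j v * g v)"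
proof -
  have dm: "(mL i has_field_derivative mL (Suc i) x) (at x)"
    using diff by (simp add: field_differentiable_derivI)
  have "((\<lambda>y. mL i y * (LINT v:upper_ray u y|lborel. PU p u j v * g v)) has_field_derivative
      mL (Suc i) x * (LINT v:upper_ray u x|lborel. PU p u j v * g v) - mL i x * (PU p u j x * g x)) (at x) \<and>
      (mL (Suc i) x \<noteq> 0 \<longrightarrow> set_integrable lborel (upper_ray u x) (\<lambda>v. PU p u j v * g v))"
  proof (cases "\<exists>y\<in>I. mL i y \<noteq> 0")
    case True
    then obtain y where y: "y \<in> I" "mL i y \<noteq> 0" by blast
    have all: "set_integrable lborel (upper_ray u z) (\<lambda>v. PU p u j v * g v)" if "z \<in> I" for z
      using fin g y(1) int[OF y] that by (rule upper_integrable_all)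
    obtain a b where ab: "a < x" "x < b" "a \<in> I" "b \<in> I" using interval_in_I[OF x] .
    have "isCont g x" using g by (simp add: continuous_on_eq_continuous_at)
    then have "isCont (\<lambda>v. PU p u j v * g v) x" using cont by (intro continuous_intros)
    then have "((\<lambda>y. LINT v:upper_ray u y|lborel. PU p u j v * g v) has_field_derivative - (PU p u j x * g x)) (at x)"
      using all[OF ab(3)] I_range[OF ab(4)] ab by (intro upper_ray_deriv[where a = a and b = b]) auto
    with dm all[OF x] show ?thesis
      by (auto intro!: derivative_eq_intros simp: algebra_simps)
  next
    case False
    have "((\<lambda>_. 0) has_field_derivative mL (Suc i) x) (at x)"
      by (rule has_field_derivative_transform_within_open[OF dm open_I x]) (use False in auto)
    then have 0: "mL (Suc i) x = 0" by (rule DERIV_unique) (rule DERIV_const)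
    have "((\<lambda>y. mL i y * (LINT v:upper_ray u y|lborel. PU p u j v * g v)) has_field_derivative 0) (at x)"
      by (rule has_field_derivative_transform_within_open[OF DERIV_const[of 0] open_I x]) (use False in auto)
    with 0 False x show ?thesis by auto
  qed
  then show "((\<lambda>y. mL i y * (LINT v:upper_ray u y|lborel. PU p u j v * g v)) has_field_derivative
      mL (Suc i) x * (LINT v:upper_ray u x|lborel. PU p u j v * g v) - mL i x * (PU p u j x * g x)) (at x)"
    "mL (Suc i) x \<noteq> 0 \<Longrightarrow> set_integrable lborel (upper_ray u x) (\<lambda>v. PU p u j v * g v)" by auto
qed

text \<open>The product rule on each half gives the kernel with index i+1 plus a boundary term from
  the moving endpoint. For j >= 1 the bracket is -M^{i,j-1}; it is left expanded so that j = 0 is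
  included.\<close>

lemma kernel_deriv:
  assumes x: "x \<in> I"
    and fin: "\<And>y. y \<in> I \<Longrightarrow> P_lower p l (Suc j) y < \<infinity>" "\<And>y. y \<in> I \<Longrightarrow> P_upper p u (Suc j) y < \<infinity>"
    and cont: "isCont (PL p l j) x" "isCont (PU p u j) x" and g: "continuous_on UNIV g"
    and f: "\<And>y. y \<in> I \<Longrightarrow> expect_finite \<Omega> Z (\<lambda>v. K i j y v * g v)"
    and diff: "mU i field_differentiable (at x)" "mL i field_differentiable (at x)"
  shows "((\<lambda>y. expect \<Omega> Z (\<lambda>v. K i j y v * g v)) has_field_derivative
      expect \<Omega> Z (\<lambda>v. K (Suc i) j x v * g v)
      + g x * ((-1) ^ j * (mU i x * PL p l j x) + mL i x * PU p u j x)) (at x)"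
proof -
  have gm: "g \<in> borel_measurable borel" using g by (rule borel_measurable_continuous_onI)
  have ae: "AE v in lborel. g v = g v" by simp
  note fL = expect_K_finiteD(1)[OF _ gm ae f] and fU = expect_K_finiteD(2)[OF _ gm ae f]
  note L = lower_term_deriv[OF x fin(1) cont(1) g fL diff(1)]
  note U = upper_term_deriv[OF x fin(2) cont(2) g fU diff(2)]
  have e: "expect \<Omega> Z (\<lambda>v. K i j y v * g v) =
      (-1) ^ j * (mU i y * (LINT v:lower_ray l y|lborel. PL p l j v * g v))
      - mL i y * (LINT v:upper_ray u y|lborel. PU p u j v * g v)" if "y \<in> I" for y
    using that by (intro expect_K_split(1)[OF _ gm ae]) (auto intro: fL fU)
  have e': "expect \<Omega> Z (\<lambda>v. K (Suc i) j x v * g v) =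
      (-1) ^ j * (mU (Suc i) x * (LINT v:lower_ray l x|lborel. PL p l j v * g v))
      - mL (Suc i) x * (LINT v:upper_ray u x|lborel. PU p u j v * g v)"
    by (intro expect_K_split(1)[OF x gm ae] L(2) U(2))
  have "((\<lambda>y. (-1) ^ j * (mU i y * (LINT v:lower_ray l y|lborel. PL p l j v * g v))
      - mL i y * (LINT v:upper_ray u y|lborel. PU p u j v * g v)) has_field_derivative
      expect \<Omega> Z (\<lambda>v. K (Suc i) j x v * g v)
      + g x * ((-1) ^ j * (mU i x * PL p l j x) + mL i x * PU p u j x)) (at x)"
  proof (rule DERIV_cong[OF DERIV_diff[OF DERIV_cmult[OF L(1)] U(1)]])
    have ring: "s * (a + m * (q * y)) - (b - m' * (q' * y)) = s * a - b + y * (s * (m * q) + m' * q')"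
      for s a b m q m' q' y :: real by (simp add: algebra_simps)
    show "(-1) ^ j * (mU (Suc i) x * (LINT v:lower_ray l x|lborel. PL p l j v * g v) + mU i x * (PL p l j x * g x))
        - (mL (Suc i) x * (LINT v:upper_ray u x|lborel. PU p u j v * g v) - mL i x * (PU p u j x * g x))
      = expect \<Omega> Z (\<lambda>v. K (Suc i) j x v * g v)
        + g x * ((-1) ^ j * (mU i x * PL p l j x) + mL i x * PU p u j x)"
      unfolding e' by (rule ring)
  qed
  then show ?thesis
    by (rule has_field_derivative_transform_within_open[OF _ open_I x]) (simp add: e)
qed

section \<open>The solution as a kernel expectation, and its derivatives\<close>

lemma integral_split_at:
  assumes x: "x \<in> I" and int: "integrable lborel (\<lambda>v. p v * g v)"
  shows "set_integrable lborel (lower_ray l x) (\<lambda>v. p v * g v)"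
    and "set_integrable lborel (upper_ray u x) (\<lambda>v. p v * g v)"
    and "(\<integral>v. p v * g v \<partial>lborel) =
      (LINT v:lower_ray l x|lborel. p v * g v) + (LINT v:upper_ray u x|lborel. p v * g v)"
proof -
  show L: "set_integrable lborel (lower_ray l x) (\<lambda>v. p v * g v)"
    and U: "set_integrable lborel (upper_ray u x) (\<lambda>v. p v * g v)"
    unfolding set_integrable_def by (rule integrable_mult_indicator[OF _ int]; simp)+
  have "AE v in lborel. p v * g v = indicator (lower_ray l x) v *\<^sub>R (p v * g v)
      + indicator (upper_ray u x) v *\<^sub>R (p v * g v)"
    using AE_lborel_singleton[of x]
  proof eventually_elim
    case (elim v)
    show ?case
    proof (cases "v \<in> I")
      case True
      with I_range[of v] elim show ?thesis by (auto simp: indicator_def)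
    next
      case False
      then have "p v = 0" using I_iff[of v] p_nonneg[of v] by auto
      then show ?thesis by simp
    qed
  qed
  then have "(\<integral>v. p v * g v \<partial>lborel) = (\<integral>v. indicator (lower_ray l x) v *\<^sub>R (p v * g v)
      + indicator (upper_ray u x) v *\<^sub>R (p v * g v) \<partial>lborel)"
    using int L U unfolding set_integrable_def
    by (intro integral_cong_AE borel_measurable_integrable Bochner_Integration.integrable_add) auto
  also have "\<dots> = (LINT v:lower_ray l x|lborel. p v * g v) + (LINT v:upper_ray u x|lborel. p v * g v)"
    using L U unfolding set_integrable_def set_lebesgue_integral_def
    by (intro Bochner_Integration.integral_add) auto
  finally show "(\<integral>v. p v * g v \<partial>lborel) =
      (LINT v:lower_ray l x|lborel. p v * g v) + (LINT v:upper_ray u x|lborel. p v * g v)" .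
qed

lemma set_integral_lebesgue_eq:
  fixes f :: "real \<Rightarrow> real"
  assumes [measurable]: "f \<in> borel_measurable borel" "A \<in> sets borel"
  shows "(LINT t:A|lebesgue. f t) = (LINT t:A|lborel. f t)"
  unfolding set_lebesgue_integral_def by (rule integral_completion) measurable

lemma cdf_sum:
  assumes "x \<in> I"
  shows "cdf_lower p l x + cdf_upper p u x = 1"
    and "set_integrable lborel (lower_ray l x) p"
proof -
  interpret prob_space \<Omega> by (rule prob)
  have "integrable lborel (\<lambda>v. p v * 1)" "(\<integral>v. p v * 1 \<partial>lborel) = 1"
    using distributed_integrable[OF dens, of "\<lambda>_. 1"] distributed_integral[OF dens, of "\<lambda>_. 1"] p_nonneg
    by (simp_all add: prob_space)
  with integral_split_at[OF assms this(1)]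
  show "cdf_lower p l x + cdf_upper p u x = 1" "set_integrable lborel (lower_ray l x) p"
    by (simp_all add: cdf_lower_def cdf_upper_def set_integral_lebesgue_eq)
qed

text \<open>With A and B the integrals of p h to the left and right of x, the mean of h is A + B. As
  the two tails add up to 1, A - (A + B) P equals A times the upper tail minus B P, which is the
  kernel formula.\<close>

lemma f_sol_eq_expect:
  assumes x: "x \<in> I" and h[measurable]: "h \<in> borel_measurable borel" and fin: "expect_finite \<Omega> Z h"
  shows "f_sol \<Omega> Z p w l h x = expect \<Omega> Z (\<lambda>v. K 0 0 x v * h v)"
    and "expect_finite \<Omega> Z (\<lambda>v. K 0 0 x v * h v)"
proof -
  have ae: "AE v in lborel. p v * h v = p v * h v" by simp
  have int: "integrable lborel (\<lambda>v. p v * h v)" and E: "expect \<Omega> Z h = (\<integral>v. p v * h v \<partial>lborel)"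
    using fin expect_lborel[OF dens p_nonneg _ ae] by simp_all
  note S = integral_split_at[OF x int]
  define A where "A = (LINT v:lower_ray l x|lborel. p v * h v)"
  define B where "B = (LINT v:upper_ray u x|lborel. p v * h v)"
  have EAB: "expect \<Omega> Z h = A + B" unfolding E A_def B_def by (rule S(3))
  have "(LINT t:lower_ray l x|lebesgue. (h t - expect \<Omega> Z h) * p t) =
      (LINT t:lower_ray l x|lborel. (h t - expect \<Omega> Z h) * p t)"
    by (rule set_integral_lebesgue_eq) measurable
  also have "\<dots> = (LINT t:lower_ray l x|lborel. p t * h t - expect \<Omega> Z h * p t)"
    by (simp add: algebra_simps)
  also have "\<dots> = A - (LINT t:lower_ray l x|lborel. expect \<Omega> Z h * p t)"
    unfolding A_def using S(1) cdf_sum(2)[OF x] by (intro set_integral_diff(2)) auto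
  also have "(LINT t:lower_ray l x|lborel. expect \<Omega> Z h * p t) = (A + B) * cdf_lower p l x"
    unfolding EAB by (simp add: cdf_lower_def set_integral_lebesgue_eq)
  finally have "f_sol \<Omega> Z p w l h x = 1 / (w x * p x) * (A - (A + B) * cdf_lower p l x)"
    unfolding f_sol_def by simp
  also have "\<dots> = 1 / (w x * p x) * (A * cdf_upper p u x - B * cdf_lower p l x)"
  proof -
    have eq: "cdf_upper p u x = 1 - cdf_lower p l x" using cdf_sum(1)[OF x] by simp
    show ?thesis unfolding eq by (simp add: algebra_simps)
  qed
  also have "\<dots> = m_upper p w u x * A - m_lower p w l x * B"
    by (simp add: m_upper_def m_lower_def algebra_simps)
  finally have f: "f_sol \<Omega> Z p w l h x = m_upper p w u x * A - m_lower p w l x * B" .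
  have P0: "PL p l 0 v = p v" "PU p u 0 v = p v" for v using p_nonneg by simp_all
  note K = expect_K_split[OF x h, of h 0 0, unfolded P0]
  show "f_sol \<Omega> Z p w l h x = expect \<Omega> Z (\<lambda>v. K 0 0 x v * h v)"
    using K(1) S(1,2) unfolding f A_def B_def by simp
  show "expect_finite \<Omega> Z (\<lambda>v. K 0 0 x v * h v)"
    using K(2) S(1,2) by simp
qed

text \<open>This is -M^{0,-1} = 1/w, the boundary coefficient of the first differentiation.\<close>

lemma M_base: "x \<in> I \<Longrightarrow> mU 0 x * PL p l 0 x + mL 0 x * PU p u 0 x = 1 / w x"
proof -
  assume x: "x \<in> I"
  have "mU 0 x * PL p l 0 x + mL 0 x * PU p u 0 x = (cdf_lower p l x + cdf_upper p u x) / w x"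
    using x I_iff[of x] w_nz[of x] by (simp add: m_upper_def m_lower_def add_divide_distrib)
  then show ?thesis by (simp add: cdf_sum(1)[OF x])
qed

lemma kernel_hyp_differentiable:
  assumes H: "kernel_hyp \<Omega> Z p w l u I i j g" and x: "x \<in> I" and k: "k \<le> i"
  shows "mU k field_differentiable (at x)" "mL k field_differentiable (at x)"
proof -
  obtain U where "x \<in> U" "times_differentiable_on (i + 1) (m_lower p w l) U"
    "times_differentiable_on (i + 1) (m_upper p w u) U"
    using H x unfolding kernel_hyp_def by blast
  then show "mU k field_differentiable (at x)" "mL k field_differentiable (at x)"
    using k by (auto simp: times_differentiable_on_def)
qed

text \<open>One differentiation gives E[K^{n+1,n} g] + g/w with g the n-th derivative of h. Since
  M^{n+1,n} = -1/w, the extra term is absorbed either by integrating by parts, giving the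
  representation with the next derivative, or by replacing g(Z) with g(Z) - g(x).\<close>

lemma f_sol_derivatives:
  assumes fin: "expect_finite \<Omega> Z h" and H0: "kernel_hyp \<Omega> Z p w l u I 0 0 h"
    and H1: "\<And>k. k < n \<Longrightarrow> kernel_hyp \<Omega> Z p w l u I (Suc k) k ((deriv ^^ k) h)"
    and M_sub: "\<And>k x. k < n \<Longrightarrow> x \<in> I \<Longrightarrow> M (Suc k) k x = - 1 / w x"
  shows "times_differentiable_on n (f_sol \<Omega> Z p w l h) I" (is ?diff)
    and "x \<in> I \<Longrightarrow> (deriv ^^ n) (f_sol \<Omega> Z p w l h) x = expect \<Omega> Z (\<lambda>v. K n n x v * (deriv ^^ n) h v)"
    and "x \<in> I \<Longrightarrow> n = Suc k \<Longrightarrow> (deriv ^^ n) (f_sol \<Omega> Z p w l h) x =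
      expect \<Omega> Z (\<lambda>v. K n k x v * ((deriv ^^ k) h v - (deriv ^^ k) h x))"
proof -
  let ?f = "f_sol \<Omega> Z p w l h"
  have ac0: "loc_abs_cont_on UNIV h" using H0 by (simp add: kernel_hyp_def)
  have h: "h \<in> borel_measurable borel"
    using loc_abs_cont_on_imp_continuous_on[OF ac0] by (auto intro: borel_measurable_continuous_onI)
  \<comment> \<open>Finiteness of the expectation belongs to the induction statement because the
    next differentiation needs it at every point of \<open>I\<close>.\<close>
  have "times_differentiable_on n ?f I \<and> (\<forall>x\<in>I. expect_finite \<Omega> Z (\<lambda>v. K n n x v * (deriv ^^ n) h v) \<and>
      (deriv ^^ n) ?f x = expect \<Omega> Z (\<lambda>v. K n n x v * (deriv ^^ n) h v) \<and>
      (\<forall>k. n = Suc k \<longrightarrow> (deriv ^^ n) ?f x =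
        expect \<Omega> Z (\<lambda>v. K n k x v * ((deriv ^^ k) h v - (deriv ^^ k) h x))))"
    using H1 M_sub
  proof (induction n)
    case 0
    show ?case using f_sol_eq_expect[OF _ h fin] by (simp add: times_differentiable_on_def)
  next
    case (Suc n)
    define g where "g = (deriv ^^ n) h"
    have dg: "(deriv ^^ Suc n) h = deriv g" by (simp add: g_def)
    have IH1: "times_differentiable_on n ?f I"
      and IH2: "\<And>y. y \<in> I \<Longrightarrow> expect_finite \<Omega> Z (\<lambda>v. K n n y v * g v)"
      and IH3: "\<And>y. y \<in> I \<Longrightarrow> (deriv ^^ n) ?f y = expect \<Omega> Z (\<lambda>v. K n n y v * g v)"
      using Suc by (simp_all add: g_def)
    have H: "kernel_hyp \<Omega> Z p w l u I (Suc n) n g" unfolding g_def by (rule Suc.prems(1)) simp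
    have Hfin: "\<And>y. y \<in> I \<Longrightarrow> P_lower p l (Suc n) y < \<infinity>" "\<And>y. y \<in> I \<Longrightarrow> P_upper p u (Suc n) y < \<infinity>"
      and ac: "loc_abs_cont_on UNIV g"
      using H by (auto simp: kernel_hyp_def)
    have g: "continuous_on UNIV g" by (rule loc_abs_cont_on_imp_continuous_on[OF ac]) simp
    have gm: "g \<in> borel_measurable borel" using g by (rule borel_measurable_continuous_onI)
    \<comment> \<open>Continuity of the n-th iterated integrals needs their finiteness, which the
      hypothesis at the previous index k = n - 1 supplies; n = 0 concerns only the density.\<close>
    have Hfin': "P_lower p l n y < \<infinity> \<and> P_upper p u n y < \<infinity>" if "n = Suc k" "y \<in> I" for k y
      using Suc.prems(1)[of k] that by (auto simp: kernel_hyp_def)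
    have step: "((deriv ^^ n) ?f has_field_derivative
        expect \<Omega> Z (\<lambda>v. K (Suc n) n x v * g v) + g x / w x) (at x)" if x: "x \<in> I" for x
    proof -
      have D: "((\<lambda>y. expect \<Omega> Z (\<lambda>v. K n n y v * g v)) has_field_derivative
          expect \<Omega> Z (\<lambda>v. K (Suc n) n x v * g v)
          + g x * ((-1) ^ n * (mU n x * PL p l n x) + mL n x * PU p u n x)) (at x)"
        using kernel_hyp_differentiable[OF H x, of n] PL_isCont[OF x, of n] PU_isCont[OF x, of n] Hfin'
        by (intro kernel_deriv[OF x Hfin _ _ g IH2]) auto
      \<comment> \<open>For n >= 1 the left side is -M^{n,n-1}, known from the preceding
        index.\<close>
      have "(-1) ^ n * (mU n x * PL p l n x) + mL n x * PU p u n x = 1 / w x"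
      proof (cases n)
        case 0
        then show ?thesis using M_base[OF x] by simp
      next
        case (Suc k)
        have "(-1) ^ n * (mU n x * PL p l n x) + mL n x * PU p u n x = - M n k x"
          unfolding M_def Suc by simp
        then show ?thesis using Suc.prems(2)[of k x] x \<open>n = Suc k\<close> by simp
      qed
      then have D': "((\<lambda>y. expect \<Omega> Z (\<lambda>v. K n n y v * g v)) has_field_derivative
          expect \<Omega> Z (\<lambda>v. K (Suc n) n x v * g v) + g x / w x) (at x)"
        using D by (simp only: times_divide_eq_right mult_1_right)
      show ?thesis
        by (rule has_field_derivative_transform_within_open[OF D' open_I x]) (rule IH3[symmetric])
    qed
    have td: "times_differentiable_on (Suc n) ?f I"
      using IH1 step unfolding times_differentiable_on_def
      by (auto simp: less_Suc_eq field_differentiable_def)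
    have "expect_finite \<Omega> Z (\<lambda>v. K (Suc n) (Suc n) x v * (deriv ^^ Suc n) h v) \<and>
      (deriv ^^ Suc n) ?f x = expect \<Omega> Z (\<lambda>v. K (Suc n) (Suc n) x v * (deriv ^^ Suc n) h v) \<and>
      (\<forall>k. Suc n = Suc k \<longrightarrow> (deriv ^^ Suc n) ?f x =
        expect \<Omega> Z (\<lambda>v. K (Suc n) k x v * ((deriv ^^ k) h v - (deriv ^^ k) h x)))" if x: "x \<in> I" for x
    proof -
      have d: "(deriv ^^ Suc n) ?f x = expect \<Omega> Z (\<lambda>v. K (Suc n) n x v * g v) + g x / w x"
        using DERIV_imp_deriv[OF step[OF x]] by simp
      have M: "M (Suc n) n x = - 1 / w x" using Suc.prems(2) x by simp
      have bp: "expect \<Omega> Z (\<lambda>v. K (Suc n) n x v * g v) = g x * M (Suc n) n x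
          + expect \<Omega> Z (\<lambda>v. K (Suc n) (Suc n) x v * deriv g v)"
        by (rule kernel_by_parts[OF H x])
      have dc: "expect \<Omega> Z (\<lambda>v. K (Suc n) n x v * (g v - g x)) =
          expect \<Omega> Z (\<lambda>v. K (Suc n) n x v * g v) - g x * M (Suc n) n x"
        by (rule expect_K_diff_const[OF x Hfin[OF x] gm kernel_hyp_expect_finite(1)[OF H x]])
      show ?thesis
        unfolding d dg
        using kernel_hyp_expect_finite(2)[OF H x] bp dc M by (simp add: g_def)
    qed
    with td show ?case by blast
  qed
  then show ?diff
    and "x \<in> I \<Longrightarrow> (deriv ^^ n) ?f x = expect \<Omega> Z (\<lambda>v. K n n x v * (deriv ^^ n) h v)"
    and "x \<in> I \<Longrightarrow> n = Suc k \<Longrightarrow> (deriv ^^ n) ?f x =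
      expect \<Omega> Z (\<lambda>v. K n k x v * ((deriv ^^ k) h v - (deriv ^^ k) h x))"
    by blast+
qed

end

section \<open>From the density setting to the three identities\<close>

lemma density_setting_kernel_setting:
  assumes S: "density_setting \<Omega> Z p w m e I" and l: "l = e 0" and u: "u = e m"
  shows "kernel_setting \<Omega> Z p w l u I"
proof -
  let ?J = "\<lambda>r. {x. e (r - 1) < ereal x \<and> ereal x < e r}"
  have prob: "prob_space \<Omega>" and nn: "\<And>x. 0 \<le> p x"
    and D: "distributed \<Omega> lborel Z (\<lambda>x. ennreal (p x))"
    and inc: "\<And>r. r \<in> {1..m} \<Longrightarrow> e (r - 1) < e r"
    and I: "I = (\<Union>r\<in>{1..m}. ?J r)" and pI: "{x. 0 < p x} = I"
    and w: "\<And>x. x \<in> I \<Longrightarrow> w x \<noteq> 0"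
    and ac: "\<And>r. r \<in> {1..m} \<Longrightarrow> loc_abs_cont_on (?J r) p"
    using S by (auto simp: density_setting_def)
  have openJ: "open (?J r)" for r
    using open_ereal_vimage[of "{e (r - 1)<..<e r}"] by (simp add: vimage_def)
  have mono: "e i \<le> e j" if "i \<le> j" "j \<le> m" for i j
    using that
  proof (induction rule: dec_induct)
    case (step n)
    then show ?case using inc[of "Suc n"] by (auto intro: order_trans less_imp_le)
  qed simp
  have range: "l < ereal x \<and> ereal x < u" if x: "x \<in> I" for x
  proof -
    obtain r where r: "r \<in> {1..m}" "e (r - 1) < ereal x" "ereal x < e r" using x I by auto
    then have "e 0 \<le> e (r - 1)" "e r \<le> e m" using mono[of 0 "r - 1"] mono[of r m] by auto
    with r(2,3) show ?thesis unfolding l u by (meson le_less_trans less_le_trans)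
  qed
  have exc: "x \<in> real_of_ereal ` e ` {0..m}" if x: "l < ereal x" "ereal x < u" "x \<notin> I" for x
  proof -
    \<comment> \<open>The first division point above x exists since x < u, and it is not e_0 since l
      < x, so r - 1 is a genuine predecessor. As x is in no open interval of the partition, x =
      e_{r-1}. Infinite endpoints only add the value 0 to the finite exceptional set.\<close>
    define r where "r = (LEAST r. ereal x < e r)"
    have r: "ereal x < e r" "r \<le> m"
      unfolding r_def using x(2) u by (auto intro: LeastI Least_le)
    have "r \<noteq> 0" using r x(1) l by (auto dest: less_trans)
    then have "\<not> ereal x < e (r - 1)" using not_less_Least[of "r - 1" "\<lambda>r. ereal x < e r"] by (simp add: r_def)
    moreover have "\<not> e (r - 1) < ereal x" using x(3) r \<open>r \<noteq> 0\<close> by (auto simp: I)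
    ultimately have "e (r - 1) = ereal x" by simp
    then have "x = real_of_ereal (e (r - 1))" by simp
    then show ?thesis using r by auto
  qed
  have "finite (real_of_ereal ` e ` {0..m})" by simp
  then have "real_of_ereal ` e ` {0..m} \<in> null_sets lborel"
    by (rule finite_imp_null_set_lborel)
  from AE_not_in[OF this] have AE: "AE x in lborel. l < ereal x \<and> ereal x < u \<longrightarrow> x \<in> I"
    by eventually_elim (use exc in blast)
  have cont: "continuous_on I p"
    unfolding I using openJ loc_abs_cont_on_imp_continuous_on[OF ac openJ]
    by (intro continuous_on_open_UN ballI)
  show ?thesis
  proof (rule kernel_setting.intro)
    show "open I" unfolding I using openJ by blast
    show "x \<in> I \<longleftrightarrow> 0 < p x" for x using pI by blast
    show "l < ereal x \<and> ereal x < u" if "x \<in> I" for x using that by (rule range)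
  qed (fact prob D nn AE cont w)+
qed

text \<open>The identities for M are assumed exactly at those r where the corresponding kernel
  hypothesis holds, which is how "defined" is read. As \<open>deriv\<close> is total, existence of
  the derivatives of the solution is a conclusion of its own, and only the last identity is
  conditional on the hypothesis at (n,n).\<close>

theorem corollary2p30:
  fixes \<Omega> :: "'a measure" and Z :: "'a \<Rightarrow> real"
    and p w h :: "real \<Rightarrow> real"
    and m n :: nat and e :: "nat \<Rightarrow> ereal" and l u :: ereal and I :: "real set"
  assumes setting: "density_setting \<Omega> Z p w m e I" and l: "l = e 0" and u: "u = e m"
    and h_L1: "expect_finite \<Omega> Z h"
    and M_sub: "\<And>r. 1 \<le> r \<Longrightarrow> kernel_hyp_deriv \<Omega> Z p w l u I r (r - 1) (r - 1) h
                  \<Longrightarrow> \<forall>x\<in>I. M_kernel p w l u r (int r - 1) x = - 1 / w x"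
    and M_diag: "\<And>r. kernel_hyp_deriv \<Omega> Z p w l u I r r r h
                  \<Longrightarrow> \<forall>x\<in>I. M_kernel p w l u r (int r) x = 0"
    and H0: "kernel_hyp_deriv \<Omega> Z p w l u I 0 0 0 h"
    and H1: "\<And>k. 1 \<le> k \<Longrightarrow> k \<le> n \<Longrightarrow> kernel_hyp_deriv \<Omega> Z p w l u I k (k - 1) (k - 1) h"
    and H2: "\<And>k. 1 \<le> k \<Longrightarrow> k \<le> n - 1 \<Longrightarrow>
                  kernel_hyp_deriv \<Omega> Z p w l u I (k + 1) (k - 1) (k - 1) h"
  shows "times_differentiable_on n (f_sol \<Omega> Z p w l h) I \<and>
    (\<forall>x\<in>I.
      (1 \<le> n \<longrightarrow>
         (deriv ^^ n) (f_sol \<Omega> Z p w l h) x =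
           expect \<Omega> Z (\<lambda>v. K_kernel p w l u n (n - 1) x v
                            * ((deriv ^^ (n - 1)) h v - (deriv ^^ (n - 1)) h x))) \<and>
      (deriv ^^ n) (f_sol \<Omega> Z p w l h) x =
        expect \<Omega> Z (\<lambda>v. K_kernel p w l u n n x v * (deriv ^^ n) h v) \<and>
      (kernel_hyp_deriv \<Omega> Z p w l u I n n n h \<longrightarrow>
         (deriv ^^ n) (f_sol \<Omega> Z p w l h) x =
           expect \<Omega> Z (\<lambda>v. K_kernel p w l u n (n + 1) x v * (deriv ^^ (n + 1)) h v)))"
proof -
  interpret kernel_setting \<Omega> Z p w l u I
    by (rule density_setting_kernel_setting[OF setting l u])
  have H0': "kernel_hyp \<Omega> Z p w l u I 0 0 h"
    using H0 by (simp add: kernel_hyp_deriv_def)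
  have H1': "kernel_hyp \<Omega> Z p w l u I (Suc k) k ((deriv ^^ k) h)" if "k < n" for k
    using H1[of "Suc k"] that by (simp add: kernel_hyp_deriv_def)
  have M_sub': "M (Suc k) k x = - 1 / w x" if "k < n" "x \<in> I" for k x
    using M_sub[of "Suc k"] H1[of "Suc k"] that M_kernel_eq[of "Suc k" k x] by simp
  have diff: "times_differentiable_on n (f_sol \<Omega> Z p w l h) I"
    using h_L1 H0' H1' M_sub' by (rule f_sol_derivatives(1))
  have second: "(deriv ^^ n) (f_sol \<Omega> Z p w l h) x = expect \<Omega> Z (\<lambda>v. K n n x v * (deriv ^^ n) h v)"
    if "x \<in> I" for x
    using h_L1 H0' H1' M_sub' that by (rule f_sol_derivatives(2))
  have third: "(deriv ^^ n) (f_sol \<Omega> Z p w l h) x =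
      expect \<Omega> Z (\<lambda>v. K n (Suc n) x v * (deriv ^^ Suc n) h v)"
    if H: "kernel_hyp_deriv \<Omega> Z p w l u I n n n h" and x: "x \<in> I" for x
  proof -
    \<comment> \<open>The boundary term of a further integration by parts vanishes, so the second
      index rises while the order of the derivative of the solution stays n.\<close>
    have "M n n x = 0" using M_diag[OF H] x by (simp add: M_kernel_eq)
    moreover have "kernel_hyp \<Omega> Z p w l u I n n ((deriv ^^ n) h)"
      using H by (simp add: kernel_hyp_deriv_def)
    ultimately show ?thesis
      using second[OF x] kernel_by_parts[of n n "(deriv ^^ n) h" x] x by simp
  qed
  have first: "(deriv ^^ n) (f_sol \<Omega> Z p w l h) x =
      expect \<Omega> Z (\<lambda>v. K n (n - 1) x v * ((deriv ^^ (n - 1)) h v - (deriv ^^ (n - 1)) h x))"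
    if "1 \<le> n" "x \<in> I" for x
  proof -
    have n: "n = Suc (n - 1)" using that by simp
    show ?thesis
      using h_L1 H0' H1' M_sub' \<open>x \<in> I\<close> n by (rule f_sol_derivatives(3))
  qed
  show ?thesis
    using diff first second third by simp
qed

end
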